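(* Fix a prime power $q$ and integers $k\ge2$ and $s\ge2$. Suppose that $n\ge2k+1$ when $s=2$, and that $n\ge(2s-1)k-s+4$ when $s\ge3$. Let $V$ be an $n$-dimensional vector space over $\mathbb{F}_q$. If $\mathcal{F}\subsetneq\mathrm{Gr}_k(V)$ and $$\sigma_{k,q}(\mathcal{F})>\binom{k}{1}_q\left(\binom{n-1}{k-1}_q-q^{(s-1)(k-1)}\binom{n-s}{k-1}_q\right),$$ then $\nu_\oplus(\mathcal{F})\ge s$.
   Context: $\binom{a}{b}_q=\prod_{i=0}^{b-1}\frac{q^{a-i}-1}{q^{b-i}-1}$ is the Gaussian coefficient, with $\binom{a}{b}_q=0$ if $b<0$ or $b>a$. $\mathrm{Gr}_k(V)$ is the set of all $k$-dimensional subspaces of $V$; the elements of $\mathrm{Gr}_1(V)$ are called points. For a point $x$, $d_{\mathcal{F}}(x)=|\{F\in\mathcal{F}:x\le F\}|$; for $S\in\mathrm{Gr}_k(V)$, $d_{\mathcal{F}}(S)=\sum_{x\in\mathrm{Gr}_1(S)}d_{\mathcal{F}}(x)$. For $\mathcal{F}\ne\mathrm{Gr}_k(V)$ the projective Ore-degree is $\sigma_{k,q}(\mathcal{F})=\min\{d_{\mathcal{F}}(S):S\in\mathrm{Gr}_k(V)\setminus\mathcal{F}\}$. A direct-sum matching of size $s$ in $\mathcal{F}$ is a collection $F_1,\dots,F_s\in\mathcal{F}$ with $\dim(F_1+\cdots+F_s)=sk$. The direct-sum matching number $\nu_\oplus(\mathcal{F})$ is the largest possible such $s$. *)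

theory Defs
  imports Complex_Main "HOL-Library.Cardinality"
begin

text \<open>The Gaussian coefficient for natural arguments; the lower argument is never negative here.
  For \<open>b \<le> a\<close> the subtractions \<open>a - i\<close> and \<open>b - i\<close> with \<open>i < b\<close> are not truncated.\<close>

definition gauss_coeff :: "nat \<Rightarrow> nat \<Rightarrow> nat \<Rightarrow> real" where
  "gauss_coeff q a b =
     (if b > a then 0
      else (\<Prod>i<b. (real q ^ (a - i) - 1) / (real q ^ (b - i) - 1)))"

definition Gr :: "('a::field \<Rightarrow> 'b::ab_group_add \<Rightarrow> 'b) \<Rightarrow> nat \<Rightarrow> 'b set \<Rightarrow> 'b set set" where
  "Gr scale k W = {U. module.subspace scale U \<and> U \<subseteq> W \<and> vector_space.dim scale U = k}"

definition point_degree :: "'b set set \<Rightarrow> 'b set \<Rightarrow> nat" where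
  "point_degree \<F> x = card {F \<in> \<F>. x \<subseteq> F}"

definition subspace_degree ::
    "('a::field \<Rightarrow> 'b::ab_group_add \<Rightarrow> 'b) \<Rightarrow> 'b set set \<Rightarrow> 'b set \<Rightarrow> nat" where
  "subspace_degree scale \<F> S = (\<Sum>x\<in>Gr scale 1 S. point_degree \<F> x)"

text \<open>The projective Ore-degree. It is meaningful for finite \<open>Gr scale k UNIV\<close> and a proper
  subset \<open>\<F>\<close> of it, where the minimum ranges over a finite nonempty set.\<close>

definition ore_degree ::
    "('a::field \<Rightarrow> 'b::ab_group_add \<Rightarrow> 'b) \<Rightarrow> nat \<Rightarrow> 'b set set \<Rightarrow> nat" where
  "ore_degree scale k \<F> = Min (subspace_degree scale \<F> ` (Gr scale k UNIV - \<F>))"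

text \<open>The sum \<open>F 0 + \<dots> + F (s - 1)\<close> of subspaces is the span of their union. For \<open>k > 0\<close> the
  dimension condition forces the members to be pairwise distinct.\<close>

definition direct_sum_matching ::
    "('a::field \<Rightarrow> 'b::ab_group_add \<Rightarrow> 'b) \<Rightarrow> nat \<Rightarrow> 'b set set \<Rightarrow> nat \<Rightarrow> (nat \<Rightarrow> 'b set) \<Rightarrow> bool" where
  "direct_sum_matching scale k \<F> s F \<longleftrightarrow>
     (\<forall>i<s. F i \<in> \<F>) \<and> vector_space.dim scale (module.span scale (\<Union>i<s. F i)) = s * k"

text \<open>In finite dimension and for \<open>k > 0\<close> the set of sizes contains 0 and is bounded, so the
  maximum exists.\<close>

definition direct_sum_matching_number ::
    "('a::field \<Rightarrow> 'b::ab_group_add \<Rightarrow> 'b) \<Rightarrow> nat \<Rightarrow> 'b set set \<Rightarrow> nat" where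
  "direct_sum_matching_number scale k \<F> = Max {s. \<exists>F. direct_sum_matching scale k \<F> s F}"

end

theory Submission
  imports Defs
begin

text \<open>
  Write \<open>[m] = 1 + q + \<dots> + q ^ (m - 1)\<close>, let \<open>C\<close> and \<open>c\<close> be the numbers of \<open>k\<close>-subspaces through
  one and through two given points, and let \<open>D\<close> be the second factor of the threshold. Counting
  shows that \<open>D\<close> is the number of \<open>k\<close>-subspaces through a point \<open>x\<close> that meet a fixed
  \<open>(s - 1)\<close>-dimensional \<open>T\<close> not containing \<open>x\<close>; the family of all \<open>k\<close>-subspaces meeting \<open>T\<close> is the
  extremal configuration behind the bound. Suppose that \<open>\<F>\<close> has no direct-sum matching of size \<open>s\<close>.

  \<^bold>\<open>The case \<open>s \<ge> 3\<close>.\<close> Call a vector heavy if more than \<open>[(s - 1) k] c\<close> members contain it. At most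
  \<open>[dim U] c\<close> subspaces through a vector \<open>v\<close> outside \<open>U\<close> meet \<open>U\<close>, so a heavy vector outside a
  subspace of dimension at most \<open>(s - 1) k\<close> lies in a member avoiding that subspace. Consequently
  independent heavy vectors can be traded one after the other for members in direct sum
  (\<open>extend_matching\<close>), and the span \<open>T\<close> of the heavy vectors has some dimension \<open>t < s\<close>.
  If \<open>t = s - 1\<close>, one member avoiding \<open>T\<close> would start a matching of size \<open>s\<close>, so all members meet
  \<open>T\<close>; a \<open>k\<close>-subspace avoiding \<open>T\<close> is then a non-member whose points have degree at most \<open>D\<close>,
  against the Ore condition. If \<open>t \<le> s - 2\<close>, a maximal set of members in direct sum with each other
  and with \<open>T\<close> spans together with \<open>T\<close> a space of dimension at most \<open>(s - 1) k\<close> that all members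
  meet, either in \<open>T\<close> or in a point that is not heavy. Therefore
  \<open>|\<F>| \<le> [s - 2] C + [(s - 1) k]\<^sup>2 c\<close> (\<open>card_le_if_no_matching\<close>). On the other hand the degrees of
  the non-members average to at most \<open>[k]\<^sup>2 |\<F>| / [n]\<close> by the Cauchy-Schwarz inequality
  (\<open>min_degree_le_average\<close>), and for \<open>n\<close> in the given range these two bounds contradict the Ore
  condition (\<open>size_bound_le_degree_bound\<close>).

  \<^bold>\<open>The case \<open>s = 2\<close>.\<close> Now \<open>\<F>\<close> is intersecting, \<open>D = c\<close>, and \<open>n\<close> may be as small as \<open>2 k + 1\<close>,
  where the counting above loses too much. Let \<open>K\<close> be the adjacency operator of disjointness on
  real functions on the \<open>k\<close>-subspaces, and let \<open>f = p + r\<close> be the indicator of \<open>\<F>\<close>, split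
  orthogonally with \<open>p\<close> in the span of the indicators of the stars of points. Moebius inversion in
  subspace lattices makes \<open>K\<close> triangular for the filtration by the functions that are generated by
  incidence with subspaces of dimension at most \<open>j\<close>; reading off the diagonal shows
  \<open>\<langle>r, K r\<rangle> \<ge> - \<kappa> |r|\<^sup>2 / 2\<close>, where \<open>- \<kappa>\<close> is the eigenvalue belonging to points
  (\<open>kneser_lower_bound\<close>). Since \<open>\<F>\<close> is intersecting, \<open>\<langle>f, K f\<rangle> = 0\<close>, and this bounds
  \<open>|r|\<^sup>2 \<le> 2 (|\<F>| - |\<F>|\<^sup>2 / C)\<close>. Moreover \<open>K f\<close> is nonnegative and vanishes on \<open>\<F>\<close>, so the Ore
  condition can be summed against it: it bounds \<open>\<Sum>\<^sub>S d(S) (K f)(S)\<close> from below, while this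
  sum equals \<open>\<kappa> ([k] |\<F>|\<^sup>2 - \<Sum>\<^sub>x d(x)\<^sup>2)\<close>. As \<open>\<Sum>\<^sub>x d(x)\<^sup>2\<close> is an explicit function of
  \<open>|\<F>|\<close> and \<open>|r|\<^sup>2\<close>, the two estimates are comparable, and they are incompatible.
\<close>

section \<open>Gaussian coefficients\<close>

text \<open>The \<open>q\<close>-integer \<open>[m]\<close>, as a sum so that no division by \<open>q - 1\<close> occurs; it counts the points of an
  \<open>m\<close>-dimensional space.\<close>

definition qint :: "nat \<Rightarrow> nat \<Rightarrow> real" where
  "qint q m = (\<Sum>i<m. real q ^ i)"

lemma qint_0 [simp]: "qint q 0 = 0"
  and qint_Suc: "qint q (Suc m) = qint q m + real q ^ m"
  and qint_1 [simp]: "qint q (Suc 0) = 1"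
  by (simp_all add: qint_def)

lemma qint_nonneg [simp]: "qint q m \<ge> 0"
  by (simp add: qint_def sum_nonneg)

lemma qint_add: "qint q (a + b) = qint q a + real q ^ a * qint q b"
  by (induction b) (auto simp: qint_Suc algebra_simps power_add)

lemma qint_Suc': "qint q (Suc m) = 1 + real q * qint q m"
  using qint_add[of q 1 m] by simp

lemma qint_pos: "m > 0 \<Longrightarrow> qint q m > 0"
  by (cases m) (auto simp: qint_Suc' intro: add_pos_nonneg)

lemma power_eq_qint: "real q ^ m = 1 + (real q - 1) * qint q m"
proof (induction m)
  case (Suc m)
  have "real q ^ Suc m = real q ^ m + (real q - 1) * real q ^ m"
    by (simp add: algebra_simps)
  then show ?case
    unfolding qint_Suc distrib_left using Suc.IH by linarith
qed simp

lemma qint_mono: "a \<le> b \<Longrightarrow> qint q a \<le> qint q b"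
  unfolding qint_def by (rule sum_mono2) auto

lemma gauss_coeff_0 [simp]: "gauss_coeff q a 0 = 1"
  by (simp add: gauss_coeff_def)

lemma gauss_coeff_eq_0: "b > a \<Longrightarrow> gauss_coeff q a b = 0"
  by (simp add: gauss_coeff_def)

lemma gauss_coeff_Suc_Suc:
  assumes "q \<ge> 2"
  shows "gauss_coeff q (Suc a) (Suc b) * qint q (Suc b) = qint q (Suc a) * gauss_coeff q a b"
proof -
  have *: "real q ^ m - 1 = (real q - 1) * qint q m" for m
    by (simp add: power_eq_qint)
  have "(real q ^ Suc a - 1) / (real q ^ Suc b - 1) = qint q (Suc a) / qint q (Suc b)"
    unfolding * using assms by simp
  moreover have "gauss_coeff q (Suc a) (Suc b)
      = (real q ^ Suc a - 1) / (real q ^ Suc b - 1) * gauss_coeff q a b"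
    unfolding gauss_coeff_def prod.lessThan_Suc_shift
    by (simp del: power_Suc prod.lessThan_Suc)
  ultimately show ?thesis
    using qint_pos[of "Suc b" q] by simp
qed

lemma gauss_coeff_1: "q \<ge> 2 \<Longrightarrow> gauss_coeff q a 1 = qint q a"
  by (cases a) (use gauss_coeff_Suc_Suc[of q _ 0] in \<open>auto simp: gauss_coeff_eq_0\<close>)

text \<open>Together with \<open>gauss_coeff_Suc_Suc\<close> this moves any Gaussian coefficient to a neighbouring one
  without division. For \<open>b \<ge> a\<close> the truncated difference \<open>a - b\<close> makes both sides vanish.\<close>

lemma gauss_coeff_Suc_right:
  assumes "q \<ge> 2"
  shows "gauss_coeff q a (Suc b) * qint q (Suc b) = qint q (a - b) * gauss_coeff q a b"
proof (induction a arbitrary: b)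
  case (Suc a)
  show ?case
  proof (cases b)
    case 0
    then show ?thesis
      using gauss_coeff_1[OF assms, of "Suc a"] by simp
  next
    case (Suc c)
    have "gauss_coeff q (Suc a) (Suc b) * qint q (Suc b) * qint q b
        = qint q (Suc a) * (gauss_coeff q a (Suc c) * qint q (Suc c))"
      using gauss_coeff_Suc_Suc[OF assms, of a b] Suc by simp
    also have "\<dots> = qint q (Suc a - b) * (gauss_coeff q (Suc a) (Suc c) * qint q (Suc c))"
      unfolding Suc.IH gauss_coeff_Suc_Suc[OF assms] by (simp add: Suc)
    finally show ?thesis
      using qint_pos[of b q] Suc by simp
  qed
qed (auto simp: gauss_coeff_eq_0)

lemma gauss_coeff_nonneg: "q \<ge> 2 \<Longrightarrow> gauss_coeff q a b \<ge> 0"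
  by (auto simp: gauss_coeff_def intro!: prod_nonneg divide_nonneg_nonneg)

lemma gauss_coeff_pos: "q \<ge> 2 \<Longrightarrow> b \<le> a \<Longrightarrow> gauss_coeff q a b > 0"
  by (auto simp: gauss_coeff_def intro!: prod_pos divide_pos_pos)

lemma gauss_coeff_pascal:
  assumes "q \<ge> 2"
  shows "gauss_coeff q (Suc a) (Suc b)
    = gauss_coeff q a b + real q ^ Suc b * gauss_coeff q a (Suc b)"
proof (cases "b \<le> a")
  case True
  have "qint q (Suc a) = qint q (Suc b) + real q ^ Suc b * qint q (a - b)"
    using qint_add[of q "Suc b" "a - b"] True by simp
  then have "gauss_coeff q (Suc a) (Suc b) * qint q (Suc b)
      = (gauss_coeff q a b + real q ^ Suc b * gauss_coeff q a (Suc b)) * qint q (Suc b)"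
    unfolding gauss_coeff_Suc_Suc[OF assms] distrib_right
    using gauss_coeff_Suc_right[OF assms, of a b] by (simp add: algebra_simps del: power_Suc)
  then show ?thesis
    using qint_pos[of "Suc b" q] by (simp del: power_Suc)
qed (simp add: gauss_coeff_eq_0)

text \<open>The value \<open>(-1)^j q^(j (j - 1) / 2)\<close> of the Moebius function of the lattice of subspaces of a
  \<open>j\<close>-dimensional space.\<close>

primrec gauss_moebius :: "nat \<Rightarrow> nat \<Rightarrow> real" where
  "gauss_moebius q 0 = 1"
| "gauss_moebius q (Suc j) = - (real q ^ j) * gauss_moebius q j"

text \<open>The alternating \<open>q\<close>-binomial identity. By the Pascal recursion the partial sums telescope.\<close>

lemma gauss_moebius_sum:
  assumes "q \<ge> 2"
  shows "(\<Sum>i\<le>d. gauss_moebius q i * gauss_coeff q d i) = (if d = 0 then 1 else 0)"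
proof (cases d)
  case (Suc e)
  have "(\<Sum>i\<le>m. gauss_moebius q i * gauss_coeff q (Suc e) i)
      = gauss_moebius q m * real q ^ m * gauss_coeff q e m" for m
    by (induction m) (auto simp: gauss_coeff_pascal[OF assms] algebra_simps)
  from this[of d] show ?thesis
    by (simp add: Suc gauss_coeff_eq_0)
qed simp

section \<open>Counting subspaces over a finite field\<close>

text \<open>The field size is a parameter \<open>q\<close> so that it can be written without reference to the type.\<close>

locale finite_field_vector_space = finite_dimensional_vector_space scale Basis
  for scale :: "'a::{field,finite} \<Rightarrow> 'v::ab_group_add \<Rightarrow> 'v" (infixr \<open>*s\<close> 75)
    and Basis :: "'v set" +
  fixes q :: nat
  assumes card_field: "CARD('a) = q"
begin

lemma q_ge_2: "q \<ge> 2"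
proof -
  have "card {0, 1 :: 'a} \<le> q"
    unfolding card_field[symmetric] by (rule card_mono) auto
  then show ?thesis by simp
qed

lemma span_subspace_eq [simp]: "subspace U \<Longrightarrow> span U = U"
  by (simp only: span_eq_iff)

lemma mem_span_insert:
  assumes "subspace U"
  shows "x \<in> span (insert v U) \<longleftrightarrow> (\<exists>a. x - a *s v \<in> U)"
  using span_breakdown_eq[of x v U] assms by simp

lemma card_span_insert:
  assumes U: "subspace U" "finite U" and v: "v \<notin> U"
  shows "finite (span (insert v U)) \<and> card (span (insert v U)) = q * card U"
proof -
  let ?f = "\<lambda>(a, u). a *s v + u"
  have "x \<in> span (insert v U) \<longleftrightarrow> x \<in> ?f ` (UNIV \<times> U)" for x
  proof -
    have "x \<in> span (insert v U) \<longleftrightarrow> (\<exists>a. x - a *s v \<in> U)"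
      using U by (simp add: mem_span_insert)
    also have "\<dots> \<longleftrightarrow> x \<in> ?f ` (UNIV \<times> U)"
    proof
      assume "\<exists>a. x - a *s v \<in> U"
      then obtain a where "x - a *s v \<in> U" ..
      moreover have "x = ?f (a, x - a *s v)" by simp
      ultimately show "x \<in> ?f ` (UNIV \<times> U)" by blast
    next
      assume "x \<in> ?f ` (UNIV \<times> U)"
      then obtain a u where "x = a *s v + u" "u \<in> U" by auto
      then have "x - a *s v \<in> U" by simp
      then show "\<exists>a. x - a *s v \<in> U" ..
    qed
    finally show ?thesis .
  qed
  then have eq: "span (insert v U) = ?f ` (UNIV \<times> U)"
    by blast
  have "inj_on ?f (UNIV \<times> U)"
  proof (rule inj_onI, clarify)
    fix a u b w
    assume u: "u \<in> U" "w \<in> U" and e: "a *s v + u = b *s v + w"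
    have "(a - b) *s v = w - u"
      using e by (simp add: scale_left_diff_distrib algebra_simps)
    also have "\<dots> \<in> U"
      using U u by (simp add: subspace_diff)
    finally have "inverse (a - b) *s ((a - b) *s v) \<in> U"
      using U subspace_scale by blast
    then have "a = b"
      using v by (cases "a = b") auto
    then show "a = b \<and> u = w"
      using e by simp
  qed
  then show ?thesis
    unfolding eq using U by (simp add: card_image card_cartesian_product card_field)
qed

lemma finite_card_subspace:
  assumes "subspace U"
  shows "finite U \<and> card U = q ^ dim U"
proof -
  obtain B where B: "B \<subseteq> U" "independent B" "U \<subseteq> span B" "card B = dim U"
    using basis_exists by blast
  have "finite (span B) \<and> card (span B) = q ^ card B"
    using finiteI_independent[OF B(2)] B(2)
  proof (induction B)
    case (insert v B)
    have v: "v \<notin> span B" and ind: "independent B"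
      using insert.prems insert.hyps independent_insert by auto
    have "span (insert v B) = span (insert v (span B))"
      by (simp add: span_insert span_span)
    then show ?case
      using card_span_insert[of "span B" v] v insert.IH[OF ind] insert.hyps by simp
  qed simp
  moreover have "span B = U"
    using B assms by (simp add: span_subspace)
  ultimately show ?thesis
    using B by simp
qed

lemma finite_UNIV_v: "finite (UNIV :: 'v set)"
  using finite_card_subspace[OF subspace_UNIV] by (rule conjunct1)

lemma finite_set_v [simp, intro]: "finite (A :: 'v set)"
  by (rule finite_subset[OF subset_UNIV finite_UNIV_v])

lemma finite_sets_v [simp, intro]: "finite (\<A> :: 'v set set)"
  by (rule finite_subset[of _ "Pow UNIV"]) (auto simp: finite_UNIV_v simp del: Pow_UNIV)

lemma card_subspace: "subspace U \<Longrightarrow> card U = q ^ dim U"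
  using finite_card_subspace by blast

lemma Gr_iff: "U \<in> Gr scale a W \<longleftrightarrow> subspace U \<and> U \<subseteq> W \<and> dim U = a"
  by (auto simp: Gr_def)

lemma dim_span_Un:
  assumes "subspace S" "subspace T" "S \<inter> T = {0}"
  shows "dim (S \<union> T) = dim S + dim T"
proof -
  have "span (S \<union> T) = {x + y |x y. x \<in> S \<and> y \<in> T}"
    using assms by (simp add: span_Un)
  then have "dim (S \<union> T) = dim {x + y |x y. x \<in> S \<and> y \<in> T}"
    by (metis dim_span)
  with dim_sums_Int[OF assms(1,2)] assms(3) show ?thesis
    by simp
qed

text \<open>The sets \<open>T' - T\<close>, where \<open>T'\<close> ranges over the one-step extensions of \<open>T\<close>, partition the vectors
  outside \<open>T\<close> into classes of equal size. Hence a union \<open>Z\<close> of classes counts the extensions that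
  it contains; the two instances below take for \<open>Z\<close> the rest of a larger subspace and the complement
  of a sum.\<close>

lemma card_one_step_extensions:
  assumes T: "subspace T" "dim T = j" and Z: "Z \<inter> T = {}"
    and sat: "\<And>v. v \<in> Z \<Longrightarrow> span (insert v T) - T \<subseteq> Z"
  shows "card {T' \<in> Gr scale (Suc j) UNIV. T \<subseteq> T' \<and> T' - T \<subseteq> Z} * (q ^ Suc j - q ^ j) = card Z"
proof -
  define \<T> where "\<T> = {T' \<in> Gr scale (Suc j) UNIV. T \<subseteq> T' \<and> T' - T \<subseteq> Z}"
  have *: "T' = span (insert v T)" if "T' \<in> \<T>" "v \<in> T' - T" for T' v
  proof (rule subspace_dim_equal[symmetric])
    show "span (insert v T) \<subseteq> T'"
      using that by (intro span_minimal) (auto simp: \<T>_def Gr_iff)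
    show "dim T' \<le> dim (span (insert v T))"
      using that T by (auto simp: \<T>_def Gr_iff dim_insert)
  qed (use that in \<open>auto simp: \<T>_def Gr_iff\<close>)
  have "Z = (\<Union>T'\<in>\<T>. T' - T)"
  proof
    show "Z \<subseteq> (\<Union>T'\<in>\<T>. T' - T)"
    proof
      fix v assume v: "v \<in> Z"
      have "dim (span (insert v T)) = Suc j"
        using v Z T by (auto simp: dim_insert)
      then have "span (insert v T) \<in> \<T>"
        using sat[OF v] by (auto simp: \<T>_def Gr_iff intro: span_base)
      then show "v \<in> (\<Union>T'\<in>\<T>. T' - T)"
        using v Z span_base[of v "insert v T"] by blast
    qed
  qed (auto simp: \<T>_def)
  then have "card Z = card (\<Union>T'\<in>\<T>. T' - T)"
    by simp
  also have "\<dots> = (\<Sum>T'\<in>\<T>. card (T' - T))"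
  proof (rule card_UN_disjoint)
    show "\<forall>i\<in>\<T>. \<forall>j\<in>\<T>. i \<noteq> j \<longrightarrow> (i - T) \<inter> (j - T) = {}"
      using * by blast
  qed auto
  also have "\<dots> = (\<Sum>T'\<in>\<T>. q ^ Suc j - q ^ j)"
    using T by (intro sum.cong refl) (auto simp: \<T>_def Gr_iff card_Diff_subset card_subspace)
  finally show ?thesis
    by (simp add: \<T>_def)
qed

text \<open>Turns the vector count of the previous lemma, \<open>x (q^(j + 1) - q^j) = q^b - q^(j + m)\<close>, into
  \<open>q\<close>-integers.\<close>

lemma qint_extensions:
  assumes "x * (q ^ Suc j - q ^ j) = q ^ b - q ^ (j + m)" and "j + m \<le> b"
  shows "real x = real q ^ m * qint q (b - m - j)"
proof -
  have q: "real q > 1"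
    using q_ge_2 by simp
  have le: "q ^ j \<le> q ^ Suc j" "q ^ (j + m) \<le> q ^ b"
    using assms(2) q_ge_2 by (auto intro!: power_increasing)
  have "real x * (real q ^ Suc j - real q ^ j) = real q ^ b - real q ^ (j + m)"
    using arg_cong[OF assms(1), of real] le by (simp add: of_nat_diff del: power_Suc)
  also have "real q ^ b = real q ^ (j + m) * real q ^ (b - m - j)"
    using assms(2) by (simp flip: power_add)
  also have "\<dots> - real q ^ (j + m) = real q ^ (j + m) * ((real q - 1) * qint q (b - m - j))"
    unfolding power_eq_qint[of q "b - m - j"] by (simp add: algebra_simps)
  finally have "real x * (real q ^ j * (real q - 1))
      = (real q ^ m * qint q (b - m - j)) * (real q ^ j * (real q - 1))"
    by (simp only: power_add power_Suc) (simp add: algebra_simps)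
  then show ?thesis
    using q by simp
qed

lemma card_one_step_between:
  assumes "subspace T" "subspace U" "T \<subseteq> U"
  shows "real (card {T' \<in> Gr scale (Suc (dim T)) UNIV. T \<subseteq> T' \<and> T' \<subseteq> U})
    = qint q (dim U - dim T)"
proof -
  have "card {T' \<in> Gr scale (Suc (dim T)) UNIV. T \<subseteq> T' \<and> T' - T \<subseteq> U - T}
      * (q ^ Suc (dim T) - q ^ dim T) = card (U - T)"
  proof (rule card_one_step_extensions)
    fix v assume "v \<in> U - T"
    then have "span (insert v T) \<subseteq> U"
      using assms by (intro span_minimal) auto
    then show "span (insert v T) - T \<subseteq> U - T" by blast
  qed (use assms in auto)
  also have "card (U - T) = q ^ dim U - q ^ (dim T + 0)"
    using assms by (simp add: card_Diff_subset card_subspace)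
  finally have "real (card {T' \<in> Gr scale (Suc (dim T)) UNIV. T \<subseteq> T' \<and> T' - T \<subseteq> U - T})
      = qint q (dim U - dim T)"
    using qint_extensions[where m = 0] dim_subset[OF assms(3)] by fastforce
  moreover have "{T' \<in> Gr scale (Suc (dim T)) UNIV. T \<subseteq> T' \<and> T' - T \<subseteq> U - T}
      = {T' \<in> Gr scale (Suc (dim T)) UNIV. T \<subseteq> T' \<and> T' \<subseteq> U}"
    using assms by blast
  ultimately show ?thesis by simp
qed

lemma card_one_step_avoiding:
  assumes T: "subspace T" and S: "subspace S" and W: "subspace W"
    and TW: "T \<subseteq> W" and SW: "S \<subseteq> W" and TS: "T \<inter> S = {0}"
  shows "real (card {T' \<in> Gr scale (Suc (dim T)) W. T \<subseteq> T' \<and> T' \<inter> S = {0}})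
    = real q ^ dim S * qint q (dim W - dim S - dim T)"
proof -
  \<comment> \<open>An extension \<open>T'\<close> avoids \<open>S\<close> iff it contains no vector of \<open>T + S\<close> outside \<open>T\<close>.\<close>
  define Y where "Y = span (T \<union> S)"
  have Y: "subspace Y" "T \<subseteq> Y" "S \<subseteq> Y" "Y \<subseteq> W"
    using TW SW W span_superset[of "T \<union> S"] span_minimal[of "T \<union> S" W] by (auto simp: Y_def)
  have Y_eq: "Y = {x + y |x y. x \<in> T \<and> y \<in> S}"
    using T S by (simp add: Y_def span_Un)
  have dimY: "dim Y = dim T + dim S"
    using dim_span_Un[OF T S TS] by (simp add: Y_def)
  have "card {T' \<in> Gr scale (Suc (dim T)) UNIV. T \<subseteq> T' \<and> T' - T \<subseteq> W - Y}
      * (q ^ Suc (dim T) - q ^ dim T) = card (W - Y)"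
  proof (rule card_one_step_extensions)
    fix v assume v: "v \<in> W - Y"
    show "span (insert v T) - T \<subseteq> W - Y"
    proof
      fix w assume w: "w \<in> span (insert v T) - T"
      then obtain a where a: "w - a *s v \<in> T"
        using T by (auto simp: mem_span_insert)
      have "a \<noteq> 0"
        using a w by auto
      have "w \<in> W"
        using w v TW W span_minimal[of "insert v T" W] by blast
      moreover have "w \<notin> Y"
      proof
        assume "w \<in> Y"
        then have "w - (w - a *s v) \<in> Y"
          using a Y subspace_diff by blast
        then have "a *s v \<in> Y" by (simp add: algebra_simps)
        then have "inverse a *s (a *s v) \<in> Y"
          by (rule subspace_scale[OF Y(1)])
        then show False
          using v \<open>a \<noteq> 0\<close> by simp
      qed
      ultimately show "w \<in> W - Y" by blast
    qed
  qed (use T Y in auto)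
  also have "card (W - Y) = q ^ dim W - q ^ (dim T + dim S)"
    using Y W by (simp add: card_Diff_subset card_subspace dimY)
  finally have "real (card {T' \<in> Gr scale (Suc (dim T)) UNIV. T \<subseteq> T' \<and> T' - T \<subseteq> W - Y})
      = real q ^ dim S * qint q (dim W - dim S - dim T)"
    using dim_subset[OF Y(4)] by (intro qint_extensions) (auto simp: dimY)
  moreover have "{T' \<in> Gr scale (Suc (dim T)) UNIV. T \<subseteq> T' \<and> T' - T \<subseteq> W - Y}
      = {T' \<in> Gr scale (Suc (dim T)) W. T \<subseteq> T' \<and> T' \<inter> S = {0}}" (is "?L = ?R")
  proof (intro set_eqI iffI)
    fix U assume U: "U \<in> ?L"
    then have sub: "subspace U" by (auto simp: Gr_iff)
    have "U \<inter> S \<subseteq> T"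
      using U Y by blast
    then have "U \<inter> S \<subseteq> {0}"
      using TS by blast
    then have "U \<inter> S = {0}"
      using subspace_0[OF sub] subspace_0[OF S] by blast
    moreover have "U \<subseteq> W"
      using U TW by blast
    ultimately show "U \<in> ?R"
      using U by (auto simp: Gr_iff)
  next
    fix U assume U: "U \<in> ?R"
    then have sub: "subspace U" "U \<subseteq> W" "T \<subseteq> U" "U \<inter> S = {0}"
      by (auto simp: Gr_iff)
    have "u \<in> T" if u: "u \<in> U" "u \<in> Y" for u
    proof -
      obtain x y where xy: "u = x + y" "x \<in> T" "y \<in> S"
        using u(2) Y_eq by blast
      have "u - x \<in> U"
        using u sub xy(2) by (intro subspace_diff) auto
      then have "y \<in> U"
        using xy(1) by simp
      then have "y = 0"
        using sub(4) xy(3) by blast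
      then show ?thesis
        using xy by simp
    qed
    then show "U \<in> ?L"
      using U by (auto simp: Gr_iff)
  qed
  ultimately show ?thesis by simp
qed

text \<open>The one counting formula behind all others. Both sides satisfy the same recursion: count the
  pairs of a one-step extension \<open>T'\<close> of \<open>T\<close> avoiding \<open>S\<close> and an extension \<open>U\<close> of \<open>T'\<close> in two ways.\<close>

theorem card_extensions_avoiding:
  assumes T: "subspace T" "T \<subseteq> W" and S: "subspace S" "S \<subseteq> W" and W: "subspace W"
    and TS: "T \<inter> S = {0}"
  shows "real (card {U \<in> Gr scale (dim T + d) W. T \<subseteq> U \<and> U \<inter> S = {0}})
    = real q ^ (dim S * d) * gauss_coeff q (dim W - dim S - dim T) d"
  using T TS
proof (induction d arbitrary: T)
  case 0
  have "U = T" if "subspace U" "dim U = dim T" "T \<subseteq> U" for U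
    using subspace_dim_equal[of T U] that 0 by simp
  then have "{U \<in> Gr scale (dim T + 0) W. T \<subseteq> U \<and> U \<inter> S = {0}} = {T}"
    using 0 by (auto simp: Gr_iff)
  then show ?case by simp
next
  case (Suc d)
  define j where "j = dim T"
  define \<U> where "\<U> = {U \<in> Gr scale (j + Suc d) W. T \<subseteq> U \<and> U \<inter> S = {0}}"
  define \<T> where "\<T> = {T' \<in> Gr scale (Suc j) W. T \<subseteq> T' \<and> T' \<inter> S = {0}}"
  have "(\<Sum>U\<in>\<U>. real (card {T' \<in> \<T>. T' \<subseteq> U})) = (\<Sum>T'\<in>\<T>. real (card {U \<in> \<U>. T' \<subseteq> U}))"
    using sum.swap_restrict[of \<U> \<T> "\<lambda>_ _. 1::real" "\<lambda>U T'. T' \<subseteq> U"] by simp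
  moreover have "real (card {T' \<in> \<T>. T' \<subseteq> U}) = qint q (Suc d)" if "U \<in> \<U>" for U
  proof -
    have U: "subspace U" "U \<subseteq> W" "T \<subseteq> U" "U \<inter> S = {0}" "dim U = j + Suc d"
      using that by (auto simp: \<U>_def Gr_iff)
    have "T' \<inter> S = {0}" if "subspace T'" "T' \<subseteq> U" for T'
      using that U(4) subspace_0[OF that(1)] subspace_0[OF S(1)] by blast
    then have "{T' \<in> \<T>. T' \<subseteq> U} = {T' \<in> Gr scale (Suc (dim T)) UNIV. T \<subseteq> T' \<and> T' \<subseteq> U}"
      using U by (auto simp: \<T>_def Gr_iff j_def)
    then show ?thesis
      using card_one_step_between[OF Suc.prems(1) U(1,3)] U(5) by (simp add: j_def)
  qed
  moreover have "real (card {U \<in> \<U>. T' \<subseteq> U})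
      = real q ^ (dim S * d) * gauss_coeff q (dim W - dim S - Suc j) d" if "T' \<in> \<T>" for T'
  proof -
    have T': "subspace T'" "T' \<subseteq> W" "T \<subseteq> T'" "T' \<inter> S = {0}" "dim T' = Suc j"
      using that by (auto simp: \<T>_def Gr_iff)
    have "{U \<in> \<U>. T' \<subseteq> U} = {U \<in> Gr scale (dim T' + d) W. T' \<subseteq> U \<and> U \<inter> S = {0}}"
      using T' by (auto simp: \<U>_def Gr_iff)
    then show ?thesis
      using Suc.IH[OF T'(1,2,4)] by (simp add: T'(5))
  qed
  ultimately have "real (card \<U>) * qint q (Suc d)
      = real (card \<T>) * (real q ^ (dim S * d) * gauss_coeff q (dim W - dim S - Suc j) d)"
    by simp
  also have "real (card \<T>) = real q ^ dim S * qint q (dim W - dim S - j)"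
    using card_one_step_avoiding[OF Suc.prems(1) S(1) W Suc.prems(2) S(2) Suc.prems(3)]
    by (simp add: \<T>_def j_def)
  also have "\<dots> * (real q ^ (dim S * d) * gauss_coeff q (dim W - dim S - Suc j) d)
      = real q ^ (dim S * Suc d) * (qint q (dim W - dim S - j) * gauss_coeff q (dim W - dim S - Suc j) d)"
    by (simp add: power_add)
  also have "qint q (dim W - dim S - j) * gauss_coeff q (dim W - dim S - Suc j) d
      = gauss_coeff q (dim W - dim S - j) (Suc d) * qint q (Suc d)"
  proof (cases "dim W - dim S - j")
    case (Suc r)
    then have "dim W - dim S - Suc j = r" by simp
    then show ?thesis
      using gauss_coeff_Suc_Suc[OF q_ge_2, of r d] Suc by simp
  qed (simp add: gauss_coeff_eq_0)
  finally show ?case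
    using qint_pos[of "Suc d" q] by (simp add: \<U>_def j_def)
qed

corollary card_extensions:
  assumes T: "subspace T" "T \<subseteq> W" and W: "subspace W"
  shows "real (card {U \<in> Gr scale (dim T + d) W. T \<subseteq> U}) = gauss_coeff q (dim W - dim T) d"
proof -
  have "U \<inter> {0} = {0}" if "subspace U" for U
    using that subspace_0 by auto
  then have "{U \<in> Gr scale (dim T + d) W. T \<subseteq> U}
      = {U \<in> Gr scale (dim T + d) W. T \<subseteq> U \<and> U \<inter> {0} = {0}}"
    by (auto simp: Gr_iff)
  then show ?thesis
    using card_extensions_avoiding[OF T, of "{0}" d] W T subspace_0 by simp
qed

corollary card_Gr:
  assumes "subspace W"
  shows "real (card (Gr scale d W)) = gauss_coeff q (dim W) d"
proof -
  have "{U \<in> Gr scale d W. {0} \<subseteq> U} = Gr scale d W"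
    by (auto simp: Gr_iff subspace_0)
  then show ?thesis
    using card_extensions[of "{0}" W d] assms subspace_0 by simp
qed

end

section \<open>Point degrees and averaging\<close>

text \<open>The Cauchy-Schwarz inequality against the constant function: the variance of \<open>f\<close> is
  nonnegative.\<close>

lemma sum_power2_ge:
  fixes f :: "'i \<Rightarrow> real"
  assumes "finite I"
  shows "(\<Sum>i\<in>I. f i)\<^sup>2 \<le> (\<Sum>i\<in>I. (f i)\<^sup>2) * real (card I)"
proof (cases "I = {}")
  case False
  define N s where "N = real (card I)" and "s = (\<Sum>i\<in>I. f i)"
  have N: "N > 0"
    using False assms by (simp add: N_def card_gt_0_iff)
  have "0 \<le> (\<Sum>i\<in>I. (N * f i - s)\<^sup>2)"
    by (simp add: sum_nonneg)
  also have "\<dots> = (\<Sum>i\<in>I. N\<^sup>2 * (f i)\<^sup>2 - (2 * N * s) * f i + s\<^sup>2)"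
    by (intro sum.cong) (auto simp: power2_eq_square algebra_simps)
  also have "\<dots> = N\<^sup>2 * (\<Sum>i\<in>I. (f i)\<^sup>2) - (2 * N * s) * s + N * s\<^sup>2"
    unfolding sum.distrib sum_subtractf sum_distrib_left[symmetric] s_def[symmetric]
    by (simp add: N_def)
  also have "\<dots> = N * ((\<Sum>i\<in>I. (f i)\<^sup>2) * N - s\<^sup>2)"
    by (simp add: power2_eq_square algebra_simps)
  finally show ?thesis
    using N by (simp add: zero_le_mult_iff N_def s_def)
qed simp

context finite_field_vector_space
begin

lemma Gr_eq_restrict: "Gr scale a W = {U \<in> Gr scale a UNIV. U \<subseteq> W}"
  by (auto simp: Gr_iff)

lemma GrD: "U \<in> Gr scale a W \<Longrightarrow> subspace U" "U \<in> Gr scale a W \<Longrightarrow> dim U = a"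
  "U \<in> Gr scale a W \<Longrightarrow> U \<subseteq> W"
  by (simp_all add: Gr_iff)

lemma span_singleton_in_Gr: "v \<noteq> 0 \<Longrightarrow> span {v} \<in> Gr scale 1 UNIV"
  by (simp add: Gr_iff)

lemma span_singleton_subset: "subspace U \<Longrightarrow> span {v} \<subseteq> U \<longleftrightarrow> v \<in> U"
  using span_minimal[of "{v}" U] span_base[of v "{v}"] by blast

lemma point_eq_span:
  assumes "x \<in> Gr scale 1 W"
  obtains v where "v \<noteq> 0" "x = span {v}"
proof -
  have x: "subspace x" "dim x = 1" using assms by (auto simp: Gr_iff)
  then obtain v where v: "v \<in> x" "v \<noteq> 0"
    using dim_eq_0[of x] by auto
  then have "span {v} = x"
    using x by (intro subspace_dim_equal) (auto simp: span_singleton_subset)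
  with v that show ?thesis by blast
qed

lemma point_Int_subspace:
  assumes "x \<in> Gr scale 1 W" "subspace U" "\<not> x \<subseteq> U"
  shows "x \<inter> U = {0}"
proof -
  obtain v where v: "v \<noteq> 0" "x = span {v}" using assms(1) by (rule point_eq_span)
  have "u = 0" if u: "u \<in> x" "u \<in> U" for u
  proof (rule ccontr)
    assume "u \<noteq> 0"
    have "span {u} = x"
      using assms(1) u \<open>u \<noteq> 0\<close>
      by (intro subspace_dim_equal) (auto simp: span_singleton_subset Gr_iff)
    then show False
      using assms(2,3) u span_singleton_subset by blast
  qed
  then show ?thesis
    using assms subspace_0 by (auto simp: Gr_iff)
qed

lemma obtain_point:
  assumes "subspace U" "subspace F" "F \<inter> U \<noteq> {0}"
  obtains x where "x \<in> Gr scale 1 UNIV" "x \<subseteq> U" "x \<subseteq> F"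
proof -
  obtain v where "v \<in> F" "v \<in> U" "v \<noteq> 0"
    using assms subspace_0 by blast
  then show ?thesis
    using that[of "span {v}"] assms span_singleton_in_Gr span_singleton_subset by simp
qed

lemma card_points: "subspace U \<Longrightarrow> real (card (Gr scale 1 U)) = qint q (dim U)"
  by (simp add: card_Gr gauss_coeff_1[OF q_ge_2, simplified])

lemma card_containing_point:
  assumes "x \<in> Gr scale 1 UNIV" "k \<ge> 1"
  shows "real (card {F \<in> Gr scale k UNIV. x \<subseteq> F}) = gauss_coeff q (dim (UNIV :: 'v set) - 1) (k - 1)"
  using card_extensions[of x UNIV "k - 1"] assms by (simp add: Gr_iff)

lemma card_containing_two_points:
  assumes "x \<in> Gr scale 1 UNIV" "y \<in> Gr scale 1 UNIV" "x \<noteq> y" "k \<ge> 2"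
  shows "real (card {F \<in> Gr scale k UNIV. x \<subseteq> F \<and> y \<subseteq> F})
    = gauss_coeff q (dim (UNIV :: 'v set) - 2) (k - 2)"
proof -
  have sub: "subspace x" "subspace y" "dim x = 1" "dim y = 1"
    using assms by (auto simp: Gr_iff)
  have "\<not> x \<subseteq> y"
    using subspace_dim_equal[OF sub(1,2)] sub assms(3) by auto
  then have "x \<inter> y = {0}"
    using point_Int_subspace assms(1) sub by blast
  then have "dim (span (x \<union> y)) = 2"
    using dim_span_Un[OF sub(1,2)] sub by simp
  moreover have "{F \<in> Gr scale k UNIV. span (x \<union> y) \<subseteq> F} = {F \<in> Gr scale k UNIV. x \<subseteq> F \<and> y \<subseteq> F}"
    using span_superset[of "x \<union> y"] span_minimal[of "x \<union> y"] by (auto simp: Gr_iff)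
  ultimately show ?thesis
    using card_extensions[of "span (x \<union> y)" UNIV "k - 2"] assms(4) by (simp add: Suc_diff_Suc numeral_2_eq_2)
qed

text \<open>A subspace through \<open>x\<close> that meets \<open>U\<close> contains a second point, which lies in \<open>U\<close>; this is the union
  bound over those points.\<close>

lemma card_meeting_le:
  assumes "x \<in> Gr scale 1 UNIV" "subspace U" "\<not> x \<subseteq> U" "k \<ge> 2"
  shows "real (card {F \<in> Gr scale k UNIV. x \<subseteq> F \<and> F \<inter> U \<noteq> {0}})
    \<le> qint q (dim U) * gauss_coeff q (dim (UNIV :: 'v set) - 2) (k - 2)"
proof -
  have "{F \<in> Gr scale k UNIV. x \<subseteq> F \<and> F \<inter> U \<noteq> {0}}
      \<subseteq> (\<Union>y\<in>Gr scale 1 U. {F \<in> Gr scale k UNIV. x \<subseteq> F \<and> y \<subseteq> F})"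
  proof
    fix F assume F: "F \<in> {F \<in> Gr scale k UNIV. x \<subseteq> F \<and> F \<inter> U \<noteq> {0}}"
    then obtain y where "y \<in> Gr scale 1 UNIV" "y \<subseteq> U" "y \<subseteq> F"
      using obtain_point[OF assms(2), of F] by (auto simp: Gr_iff)
    then show "F \<in> (\<Union>y\<in>Gr scale 1 U. {F \<in> Gr scale k UNIV. x \<subseteq> F \<and> y \<subseteq> F})"
      using F by (auto simp: Gr_iff)
  qed
  then have "card {F \<in> Gr scale k UNIV. x \<subseteq> F \<and> F \<inter> U \<noteq> {0}}
      \<le> (\<Sum>y\<in>Gr scale 1 U. card {F \<in> Gr scale k UNIV. x \<subseteq> F \<and> y \<subseteq> F})"
    by (intro order_trans[OF card_mono card_UN_le]) auto
  then have "real (card {F \<in> Gr scale k UNIV. x \<subseteq> F \<and> F \<inter> U \<noteq> {0}})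
      \<le> (\<Sum>y\<in>Gr scale 1 U. real (card {F \<in> Gr scale k UNIV. x \<subseteq> F \<and> y \<subseteq> F}))"
    by (simp flip: of_nat_sum)
  also have "\<dots> = (\<Sum>y\<in>Gr scale 1 U. gauss_coeff q (dim (UNIV :: 'v set) - 2) (k - 2))"
    using assms by (intro sum.cong refl card_containing_two_points) (auto simp: Gr_iff)
  finally show ?thesis
    using card_points[OF assms(2)] by simp
qed

text \<open>For \<open>dim U = s - 1\<close> the right-hand side is the second factor of the Ore threshold.\<close>

lemma card_meeting:
  assumes "x \<in> Gr scale 1 UNIV" "subspace U" "\<not> x \<subseteq> U" "k \<ge> 1"
  shows "real (card {F \<in> Gr scale k UNIV. x \<subseteq> F \<and> F \<inter> U \<noteq> {0}})
    = gauss_coeff q (dim (UNIV :: 'v set) - 1) (k - 1)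
      - real q ^ (dim U * (k - 1)) * gauss_coeff q (dim (UNIV :: 'v set) - dim U - 1) (k - 1)"
proof -
  let ?A = "{F \<in> Gr scale k UNIV. x \<subseteq> F}" and ?B = "{F \<in> Gr scale k UNIV. x \<subseteq> F \<and> F \<inter> U = {0}}"
  have x: "subspace x" "dim x = 1"
    using assms by (auto simp: Gr_iff)
  have "{F \<in> Gr scale k UNIV. x \<subseteq> F \<and> F \<inter> U \<noteq> {0}} = ?A - ?B"
    by blast
  moreover have "real (card (?A - ?B)) = real (card ?A) - real (card ?B)"
    by (subst card_Diff_subset) (auto intro!: of_nat_diff card_mono)
  moreover have "real (card ?B) = real q ^ (dim U * (k - 1))
      * gauss_coeff q (dim (UNIV :: 'v set) - dim U - 1) (k - 1)"
    using card_extensions_avoiding[OF x(1) _ assms(2), of UNIV "k - 1"]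
      point_Int_subspace[OF assms(1-3)] assms(4) by (simp add: x(2))
  ultimately show ?thesis
    using card_containing_point[OF assms(1,4)] by simp
qed

text \<open>Used for the family itself, where it gives the sum of the squared point degrees, and for the
  whole Grassmannian, where the second factor is constant.\<close>

lemma sum_subspace_degree:
  assumes "\<Y> \<subseteq> Gr scale k UNIV"
  shows "(\<Sum>S\<in>\<Y>. real (subspace_degree scale \<F> S))
    = (\<Sum>x\<in>Gr scale 1 UNIV. real (point_degree \<F> x) * real (point_degree \<Y> x))"
proof -
  have "(\<Sum>S\<in>\<Y>. real (subspace_degree scale \<F> S))
      = (\<Sum>S\<in>\<Y>. \<Sum>x\<in>{x \<in> Gr scale 1 UNIV. x \<subseteq> S}. real (point_degree \<F> x))"
    by (simp only: subspace_degree_def of_nat_sum flip: Gr_eq_restrict)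
  also have "\<dots> = (\<Sum>x\<in>Gr scale 1 UNIV. \<Sum>S\<in>{S \<in> \<Y>. x \<subseteq> S}. real (point_degree \<F> x))"
    by (rule sum.swap_restrict) auto
  also have "\<dots> = (\<Sum>x\<in>Gr scale 1 UNIV. real (point_degree \<F> x) * real (point_degree \<Y> x))"
    by (simp add: point_degree_def mult.commute)
  finally show ?thesis .
qed

lemma sum_point_degree:
  assumes "\<F> \<subseteq> Gr scale k UNIV"
  shows "(\<Sum>x\<in>Gr scale 1 UNIV. real (point_degree \<F> x)) = qint q k * real (card \<F>)"
proof -
  have "(\<Sum>x\<in>Gr scale 1 UNIV. real (point_degree \<F> x))
      = (\<Sum>x\<in>Gr scale 1 UNIV. \<Sum>F\<in>{F \<in> \<F>. x \<subseteq> F}. 1)"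
    by (simp add: point_degree_def)
  also have "\<dots> = (\<Sum>F\<in>\<F>. \<Sum>x\<in>{x \<in> Gr scale 1 UNIV. x \<subseteq> F}. 1)"
    by (rule sum.swap_restrict) auto
  also have "\<dots> = (\<Sum>F\<in>\<F>. qint q k)"
  proof (intro sum.cong refl)
    fix F assume "F \<in> \<F>"
    then have "subspace F" "dim F = k" using assms by (auto simp: Gr_iff)
    then show "(\<Sum>x\<in>{x \<in> Gr scale 1 UNIV. x \<subseteq> F}. 1) = qint q k"
      using card_points[of F] by (simp flip: Gr_eq_restrict)
  qed
  finally show ?thesis by (simp add: mult.commute)
qed

lemma ore_degree_le:
  assumes "S \<in> Gr scale k UNIV" "S \<notin> \<F>"
  shows "ore_degree scale k \<F> \<le> subspace_degree scale \<F> S"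
  unfolding ore_degree_def using assms by (intro Min_le) auto

lemma card_Gr_UNIV_mult:
  assumes "k \<ge> 1" "k \<le> dim (UNIV :: 'v set)"
  shows "real (card (Gr scale k (UNIV :: 'v set))) * qint q k
    = qint q (dim (UNIV :: 'v set)) * gauss_coeff q (dim (UNIV :: 'v set) - 1) (k - 1)"
proof -
  obtain a b where "dim (UNIV :: 'v set) = Suc a" "k = Suc b"
    using assms by (metis Suc_le_D One_nat_def order_trans)
  then show ?thesis
    using card_Gr[OF subspace_UNIV, of k] gauss_coeff_Suc_Suc[OF q_ge_2, of a b] by simp
qed

text \<open>Over all \<open>k\<close>-subspaces the degrees average to exactly \<open>[k]\<^sup>2 |\<F>| / [n]\<close>. The members of \<open>\<F>\<close> have
  at least this average, because their degrees sum to \<open>\<Sum>\<^sub>x d(x)\<^sup>2\<close>; so the non-members have at most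
  this average.\<close>

lemma min_degree_le_average:
  assumes F: "\<F> \<subset> Gr scale k UNIV" and k: "1 \<le> k" "k \<le> dim (UNIV :: 'v set)"
    and L: "\<And>S. S \<in> Gr scale k UNIV - \<F> \<Longrightarrow> L \<le> real (subspace_degree scale \<F> S)"
  shows "L * qint q (dim (UNIV :: 'v set)) \<le> (qint q k)\<^sup>2 * real (card \<F>)"
proof -
  let ?G = "Gr scale k (UNIV :: 'v set)" and ?P = "Gr scale 1 (UNIV :: 'v set)"
  let ?d = "\<lambda>x. real (point_degree \<F> x)"
  define n where "n = dim (UNIV :: 'v set)"
  define N f C where "N = real (card ?G)" and "f = real (card \<F>)"
    and "C = gauss_coeff q (n - 1) (k - 1)"
  have "card \<F> < card ?G"
    using F by (intro psubset_card_mono) auto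
  then have less: "f < N" by (simp add: f_def N_def)
  have "(\<Sum>S\<in>?G - \<F>. L) \<le> (\<Sum>S\<in>?G - \<F>. real (subspace_degree scale \<F> S))"
    by (intro sum_mono L)
  also have "\<dots> = (\<Sum>S\<in>?G. real (subspace_degree scale \<F> S))
      - (\<Sum>S\<in>\<F>. real (subspace_degree scale \<F> S))"
    using F by (intro sum_diff) auto
  also have "(\<Sum>S\<in>?G. real (subspace_degree scale \<F> S)) = (\<Sum>x\<in>?P. ?d x * C)"
    unfolding sum_subspace_degree[OF order_refl]
    using card_containing_point[OF _ k(1)] by (intro sum.cong refl) (simp add: point_degree_def C_def n_def)
  also have "\<dots> = qint q k * f * C"
    using sum_point_degree[of \<F> k] F by (simp add: f_def flip: sum_distrib_right)
  also have "(\<Sum>S\<in>\<F>. real (subspace_degree scale \<F> S)) = (\<Sum>x\<in>?P. (?d x)\<^sup>2)"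
    using sum_subspace_degree[of \<F> k \<F>] F by (simp add: power2_eq_square)
  finally have "(N - f) * L \<le> qint q k * f * C - (\<Sum>x\<in>?P. (?d x)\<^sup>2)"
    using F by (simp add: N_def f_def card_Diff_subset of_nat_diff card_mono)
  then have "(N - f) * L * qint q n \<le> (qint q k * f * C - (\<Sum>x\<in>?P. (?d x)\<^sup>2)) * qint q n"
    by (intro mult_right_mono) auto
  also have "\<dots> = qint q k * f * (N * qint q k) - (\<Sum>x\<in>?P. (?d x)\<^sup>2) * qint q n"
    using card_Gr_UNIV_mult[OF k] by (simp add: N_def C_def n_def algebra_simps)
  also have "\<dots> \<le> qint q k * f * (N * qint q k) - (qint q k * f)\<^sup>2"
    using sum_power2_ge[of ?P ?d] sum_point_degree[of \<F> k] F
      card_points[OF subspace_UNIV] by (simp add: f_def n_def)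
  also have "\<dots> = (N - f) * ((qint q k)\<^sup>2 * f)"
    by (simp add: power2_eq_square algebra_simps)
  finally have "(N - f) * (L * qint q n) \<le> (N - f) * ((qint q k)\<^sup>2 * f)"
    by (simp add: mult.assoc)
  then show ?thesis
    using less by (simp add: n_def f_def)
qed

end

section \<open>Heavy vectors and direct sums\<close>

context finite_field_vector_space
begin

lemma dim_Un_span: "dim (A \<union> span B) = dim (A \<union> B)"
proof -
  have "span (A \<union> span B) = span (A \<union> B)"
    by (simp only: span_Un span_span)
  then show ?thesis
    by (metis dim_span)
qed

lemma dim_Un_le: "dim (A \<union> B) \<le> dim A + dim B"
proof -
  have "dim (A \<union> B) = dim {x + y |x y. x \<in> span A \<and> y \<in> span B}"
    by (metis dim_span span_Un)
  then show ?thesis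
    using dim_sums_Int[of "span A" "span B"] by simp
qed

lemma dim_UN_le:
  assumes "\<And>i. i < m \<Longrightarrow> dim (F i) \<le> k"
  shows "dim (\<Union>i<m. F i) \<le> m * k"
  using assms
proof (induction m)
  case (Suc m)
  have "dim (\<Union>i<Suc m. F i) \<le> dim (F m) + dim (\<Union>i<m. F i)"
    using dim_Un_le by (simp add: lessThan_Suc)
  also have "\<dots> \<le> k + m * k"
    using Suc by (intro add_mono) auto
  finally show ?case by simp
qed simp

lemma exists_member_avoiding:
  assumes "\<F> \<subseteq> Gr scale k UNIV" "k \<ge> 2" "subspace U" "v \<notin> U"
    and deg: "qint q (dim U) * gauss_coeff q (dim (UNIV :: 'v set) - 2) (k - 2)
      < real (point_degree \<F> (span {v}))"
  shows "\<exists>F\<in>\<F>. v \<in> F \<and> F \<inter> U = {0}"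
proof (rule ccontr)
  assume no: "\<not> ?thesis"
  have v: "v \<noteq> 0"
    using assms(3,4) subspace_0 by blast
  have "{F \<in> \<F>. span {v} \<subseteq> F} \<subseteq> {F \<in> Gr scale k UNIV. span {v} \<subseteq> F \<and> F \<inter> U \<noteq> {0}}"
    using no assms(1) by (auto simp: span_singleton_subset Gr_iff)
  then have "point_degree \<F> (span {v}) \<le> card {F \<in> Gr scale k UNIV. span {v} \<subseteq> F \<and> F \<inter> U \<noteq> {0}}"
    unfolding point_degree_def by (intro card_mono) auto
  also have "real \<dots> \<le> qint q (dim U) * gauss_coeff q (dim (UNIV :: 'v set) - 2) (k - 2)"
    using assms v by (intro card_meeting_le span_singleton_in_Gr) (auto simp: span_singleton_subset)
  finally show False
    using deg by simp
qed

text \<open>Induction on the heavy set \<open>A\<close>: a vector \<open>v\<close> of \<open>A\<close> is replaced by a member through \<open>v\<close> that avoids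
  the span \<open>U\<close> of everything else. Such a member exists because \<open>dim U \<le> (s - 1) k\<close>. The dimension
  equation says that the \<open>m\<close> members and the vectors of \<open>A\<close> are jointly in direct sum, and it is
  preserved by the exchange.\<close>

lemma extend_matching:
  fixes A :: "'v set"
  assumes "\<F> \<subseteq> Gr scale k UNIV" "k \<ge> 2"
    and "\<And>v. v \<in> A \<Longrightarrow>
      qint q ((s - 1) * k) * gauss_coeff q (dim (UNIV :: 'v set) - 2) (k - 2)
        < real (point_degree \<F> (span {v}))"
    and "\<And>i. i < m \<Longrightarrow> F i \<in> \<F>"
    and "dim ((\<Union>i<m. F i) \<union> A) = m * k + card A" and "m + card A = s"
  shows "\<exists>F. direct_sum_matching scale k \<F> s F"
  using finite_set_v[of A] assms(3-6)
proof (induction A arbitrary: m F)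
  case empty
  then show ?case
    by (auto simp: direct_sum_matching_def)
next
  case (insert v A)
  define X where "X = (\<Union>i<m. F i)"
  define U where "U = span (X \<union> A)"
  have "dim X \<le> m * k"
    unfolding X_def using insert.prems(2) assms(1)
    by (intro dim_UN_le) (metis GrD(2) order_refl subsetD)
  moreover have "dim A \<le> card A"
    using span_superset by (intro dim_le_card) auto
  ultimately have "dim U \<le> m * k + card A"
    using dim_Un_le[of X A] by (simp add: U_def)
  moreover have "dim (insert v (X \<union> A)) = m * k + card A + 1"
    using insert.prems(3) insert.hyps by (simp add: X_def)
  \<comment> \<open>The dimension of the span is as large as possible, so \<open>v\<close> must contribute to it.\<close>
  ultimately have v: "v \<notin> U" and dimU: "dim U = m * k + card A"
    unfolding dim_insert by (auto simp: U_def split: if_splits)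
  have s: "s - 1 = m + card A"
    using insert.prems(4) insert.hyps by simp
  have "dim U \<le> (s - 1) * k"
    unfolding dimU s using assms(2) by (simp add: algebra_simps)
  then have "qint q (dim U) * gauss_coeff q (dim (UNIV :: 'v set) - 2) (k - 2)
      \<le> qint q ((s - 1) * k) * gauss_coeff q (dim (UNIV :: 'v set) - 2) (k - 2)"
    by (intro mult_right_mono qint_mono gauss_coeff_nonneg q_ge_2)
  also have "\<dots> < real (point_degree \<F> (span {v}))"
    using insert.prems(1) by blast
  finally obtain F' where F': "F' \<in> \<F>" "v \<in> F'" "F' \<inter> U = {0}"
    using exists_member_avoiding[OF assms(1,2) _ v] by (auto simp: U_def)
  have sub: "subspace F'" "dim F' = k"
    using F'(1) assms(1) by (auto simp: Gr_iff)
  define F2 where "F2 = F(m := F')"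
  have "(\<Union>i<Suc m. F2 i) = F' \<union> X"
    by (auto simp: F2_def X_def lessThan_Suc)
  then have "dim ((\<Union>i<Suc m. F2 i) \<union> A) = dim (F' \<union> U)"
    by (simp add: U_def dim_Un_span Un_assoc)
  also have "\<dots> = Suc m * k + card A"
    using dim_span_Un[OF sub(1) _ F'(3)] sub(2) dimU by (simp add: U_def)
  finally have "dim ((\<Union>i<Suc m. F2 i) \<union> A) = Suc m * k + card A" .
  then show ?case
    using insert.prems insert.hyps F'(1)
    by (intro insert.IH[of "Suc m" F2]) (auto simp: F2_def less_Suc_eq)
qed

lemma exists_disjoint_subspace:
  assumes "subspace T" "k + dim T \<le> dim (UNIV :: 'v set)"
  shows "\<exists>S\<in>Gr scale k UNIV. S \<inter> T = {0}"
proof -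
  have "real (card {S \<in> Gr scale (dim {0} + k) UNIV. {0} \<subseteq> S \<and> S \<inter> T = {0}}) > 0"
    using assms q_ge_2 subspace_0[OF assms(1)] unfolding dim_UNIV
    by (subst card_extensions_avoiding) (auto intro!: mult_pos_pos gauss_coeff_pos)
  then have "{S \<in> Gr scale k UNIV. {0} \<subseteq> S \<and> S \<inter> T = {0}} \<noteq> {}"
    by (auto simp: card_gt_0_iff)
  then show ?thesis by blast
qed

text \<open>The span \<open>T\<close> of the heavy vectors has dimension at most \<open>s - 2\<close>: dimension \<open>s\<close> or more gives a matching
  from heavy vectors alone, and dimension \<open>s - 1\<close> gives a non-member of too small degree. The bound
  is the number of members through a point of \<open>T\<close>, plus the number of those through a point, not
  heavy, of the span \<open>W\<close> of \<open>T\<close> and a maximal partial matching independent of \<open>T\<close>.\<close>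

lemma card_le_if_no_matching:
  fixes n :: nat
  assumes n: "n = dim (UNIV :: 'v set)"
    and F: "\<F> \<subseteq> Gr scale k UNIV" and k: "k \<ge> 2" and s: "s \<ge> 2" and kn: "k + s - 1 \<le> n"
    and L: "\<And>S. S \<in> Gr scale k UNIV - \<F> \<Longrightarrow> real (subspace_degree scale \<F> S)
      > qint q k * (gauss_coeff q (n - 1) (k - 1)
          - real q ^ ((s - 1) * (k - 1)) * gauss_coeff q (n - s) (k - 1))"
    and no: "\<nexists>F. direct_sum_matching scale k \<F> s F"
  shows "real (card \<F>) \<le> qint q (s - 2) * gauss_coeff q (n - 1) (k - 1)
    + (qint q ((s - 1) * k))\<^sup>2 * gauss_coeff q (n - 2) (k - 2)"
proof -
  define c C \<theta> where "c = gauss_coeff q (n - 2) (k - 2)"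
    and "C = gauss_coeff q (n - 1) (k - 1)" and "\<theta> = qint q ((s - 1) * k) * c"
  define H where "H = {v. v \<noteq> 0 \<and> \<theta> < real (point_degree \<F> (span {v}))}"
  obtain A where A: "A \<subseteq> H" "independent A" "H \<subseteq> span A"
    using maximal_independent_subset[of H] by blast
  define t T where "t = card A" and "T = span A"
  have T: "subspace T" "dim T = t"
    by (simp_all add: T_def t_def dim_eq_card_independent A)
  have no_ext: "\<not> ((\<forall>i<m. F i \<in> \<F>) \<and> dim ((\<Union>i<m. F i) \<union> A') = m * k + card A')"
    if "A' \<subseteq> A" "m + card A' = s" for A' m F
    using extend_matching[OF F k, of A' s m F] that no A(1) n
    unfolding H_def \<theta>_def c_def by fastforce
  have "t < s"
  proof (rule ccontr)
    assume "\<not> t < s"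
    then obtain A' where A': "A' \<subseteq> A" "card A' = s"
      using obtain_subset_with_card_n[of s A] by (auto simp: t_def)
    then have "dim A' = s"
      using independent_mono[OF A(2)] dim_eq_card_independent by blast
    then show False
      using no_ext[of A' 0 "\<lambda>_. {}"] A' by simp
  qed
  have meetT: "F0 \<inter> T \<noteq> {0}" if "t = s - 1" "F0 \<in> \<F>" for F0
  proof
    assume "F0 \<inter> T = {0}"
    moreover have "subspace F0" "dim F0 = k"
      using that F by (auto simp: Gr_iff)
    ultimately have "dim (F0 \<union> A) = k + t"
      using dim_span_Un[of F0 T] T by (simp add: T_def dim_Un_span)
    then show False
      using no_ext[of A 1 "\<lambda>_. F0"] that s by (simp add: t_def lessThan_Suc)
  qed
  have "t \<noteq> s - 1"
  proof
    assume t: "t = s - 1"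
    obtain S where S: "S \<in> Gr scale k UNIV" "S \<inter> T = {0}"
      using exists_disjoint_subspace[OF T(1), of k] kn s T(2) t n by auto
    have "S \<notin> \<F>"
      using meetT[OF t] S(2) by blast
    define D where "D = C - real q ^ ((s - 1) * (k - 1)) * gauss_coeff q (n - s) (k - 1)"
    have deg: "real (point_degree \<F> x) \<le> D" if "x \<in> Gr scale 1 S" for x
    proof -
      have x: "x \<in> Gr scale 1 UNIV" "x \<subseteq> S" "subspace x" "dim x = 1"
        using that by (auto simp: Gr_iff)
      have "\<not> x \<subseteq> T"
      proof
        assume "x \<subseteq> T"
        then have "x \<subseteq> {0}" using x(2) S(2) by blast
        then show False using x(4) dim_eq_0[of x] by simp
      qed
      have "point_degree \<F> x \<le> card {F \<in> Gr scale k UNIV. x \<subseteq> F \<and> F \<inter> T \<noteq> {0}}"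
        unfolding point_degree_def using F meetT[OF t] by (intro card_mono) auto
      also have "real \<dots> = D"
        using card_meeting[OF x(1) T(1) \<open>\<not> x \<subseteq> T\<close>, of k] k s t T(2) n by (simp add: D_def C_def)
      finally show ?thesis by simp
    qed
    have "real (subspace_degree scale \<F> S) = (\<Sum>x\<in>Gr scale 1 S. real (point_degree \<F> x))"
      by (simp add: subspace_degree_def)
    also have "\<dots> \<le> (\<Sum>x\<in>Gr scale 1 S. D)"
      by (intro sum_mono deg)
    also have "\<dots> = qint q k * D"
      using card_points[of S] S(1) by (simp add: Gr_iff)
    finally show False
      using L[of S] S(1) \<open>S \<notin> \<F>\<close> by (simp add: D_def C_def)
  qed
  with \<open>t < s\<close> have t: "t \<le> s - 2" by simp
  \<comment> \<open>\<open>P m\<close>: some \<open>m\<close> members are in direct sum with each other and with \<open>T\<close>.\<close>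
  define P where "P m \<longleftrightarrow> (\<exists>F. (\<forall>i<m. F i \<in> \<F>) \<and> dim ((\<Union>i<m. F i) \<union> A) = m * k + t)" for m
  have "P 0"
    by (simp add: P_def t_def dim_eq_card_independent A)
  moreover have "\<not> P (s - t)"
    using no_ext[of A "s - t"] \<open>t < s\<close> by (auto simp: P_def t_def)
  ultimately obtain m where m: "m < s - t" "P m" "\<not> P (Suc m)"
    using ex_least_nat_less[of "\<lambda>m. \<not> P m" "s - t"] by blast
  then obtain F' where F': "\<And>i. i < m \<Longrightarrow> F' i \<in> \<F>" "dim ((\<Union>i<m. F' i) \<union> A) = m * k + t"
    by (auto simp: P_def)
  define W where "W = span ((\<Union>i<m. F' i) \<union> A)"
  have W: "subspace W" "dim W = m * k + t"
    using F'(2) by (simp_all add: W_def)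
  have "T \<subseteq> W"
    by (auto simp: T_def W_def intro: span_mono[THEN subsetD])
  have meetW: "F0 \<inter> W \<noteq> {0}" if "F0 \<in> \<F>" for F0
  proof
    assume "F0 \<inter> W = {0}"
    moreover have "subspace F0" "dim F0 = k"
      using that F by (auto simp: Gr_iff)
    ultimately have "dim (F0 \<union> ((\<Union>i<m. F' i) \<union> A)) = k + (m * k + t)"
      using dim_span_Un[of F0 W] W by (simp add: W_def dim_Un_span)
    moreover have "F0 \<union> ((\<Union>i<m. F' i) \<union> A) = (\<Union>i<Suc m. (F'(m := F0)) i) \<union> A"
      by (auto simp: lessThan_Suc)
    ultimately have "P (Suc m)"
      unfolding P_def using F'(1) that
      by (intro exI[of _ "F'(m := F0)"]) (auto simp: less_Suc_eq)
    then show False using m by blast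
  qed
  have "dim W \<le> (s - 1) * k"
  proof -
    have "m * k + t \<le> (m + t) * k" using k by (simp add: algebra_simps)
    also have "\<dots> \<le> (s - 1) * k" using m(1) by (intro mult_right_mono) auto
    finally show ?thesis by (simp add: W)
  qed
  have c0: "c \<ge> 0" "C \<ge> 0" "\<theta> \<ge> 0"
    using gauss_coeff_nonneg[OF q_ge_2] by (simp_all add: c_def C_def \<theta>_def)
  define Q where "Q = {x \<in> Gr scale 1 W. \<not> x \<subseteq> T}"
  have "\<F> \<subseteq> (\<Union>x\<in>Gr scale 1 T. {F \<in> \<F>. x \<subseteq> F}) \<union> (\<Union>x\<in>Q. {F \<in> \<F>. x \<subseteq> F})"
  proof
    fix F0 assume F0: "F0 \<in> \<F>"
    then have "subspace F0" using F by (auto simp: Gr_iff)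
    then obtain x where "x \<in> Gr scale 1 UNIV" "x \<subseteq> W" "x \<subseteq> F0"
      using obtain_point[OF W(1) _ meetW[OF F0]] by blast
    then show "F0 \<in> (\<Union>x\<in>Gr scale 1 T. {F \<in> \<F>. x \<subseteq> F}) \<union> (\<Union>x\<in>Q. {F \<in> \<F>. x \<subseteq> F})"
      using F0 by (auto simp: Q_def Gr_iff)
  qed
  then have "card \<F> \<le> card ((\<Union>x\<in>Gr scale 1 T. {F \<in> \<F>. x \<subseteq> F}) \<union> (\<Union>x\<in>Q. {F \<in> \<F>. x \<subseteq> F}))"
    by (intro card_mono) auto
  also have "\<dots> \<le> (\<Sum>x\<in>Gr scale 1 T. point_degree \<F> x) + (\<Sum>x\<in>Q. point_degree \<F> x)"
    unfolding point_degree_def by (intro order_trans[OF card_Un_le] add_mono card_UN_le) auto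
  finally have "real (card \<F>)
      \<le> (\<Sum>x\<in>Gr scale 1 T. real (point_degree \<F> x)) + (\<Sum>x\<in>Q. real (point_degree \<F> x))"
    by (simp flip: of_nat_sum of_nat_add)
  also have "(\<Sum>x\<in>Gr scale 1 T. real (point_degree \<F> x)) \<le> (\<Sum>x\<in>Gr scale 1 T. C)"
  proof (intro sum_mono)
    fix x assume "x \<in> Gr scale 1 T"
    then have "x \<in> Gr scale 1 UNIV" by (auto simp: Gr_iff)
    then have "real (card {F \<in> Gr scale k UNIV. x \<subseteq> F}) = C"
      using card_containing_point[of x k] k n by (simp add: C_def)
    moreover have "point_degree \<F> x \<le> card {F \<in> Gr scale k UNIV. x \<subseteq> F}"
      unfolding point_degree_def using F by (intro card_mono) auto
    ultimately show "real (point_degree \<F> x) \<le> C" by simp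
  qed
  also have "\<dots> \<le> qint q (s - 2) * C"
    using card_points[OF T(1)] c0 qint_mono[OF t, of q] T(2) by (simp add: mult_right_mono)
  also have "(\<Sum>x\<in>Q. real (point_degree \<F> x)) \<le> (\<Sum>x\<in>Q. \<theta>)"
  proof (intro sum_mono)
    fix x assume x: "x \<in> Q"
    then obtain v where v: "v \<noteq> 0" "x = span {v}"
      using point_eq_span[of x W] by (auto simp: Q_def)
    then have "v \<notin> T"
      using x T(1) by (auto simp: Q_def span_singleton_subset)
    then have "v \<notin> H"
      using A(3) by (auto simp: T_def)
    then show "real (point_degree \<F> x) \<le> \<theta>"
      using v by (auto simp: H_def)
  qed
  also have "\<dots> \<le> qint q ((s - 1) * k) * \<theta>"
  proof -
    have "real (card Q) \<le> real (card (Gr scale 1 W))"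
      unfolding Q_def by (intro of_nat_mono card_mono) auto
    also have "\<dots> \<le> qint q ((s - 1) * k)"
      using card_points[OF W(1)] qint_mono[OF \<open>dim W \<le> (s - 1) * k\<close>, of q] by simp
    finally show ?thesis
      using c0 by (simp add: mult_right_mono)
  qed
  finally show ?thesis
    by (simp add: \<theta>_def c_def C_def power2_eq_square mult.assoc)
qed

end

section \<open>The disjointness operator on subspaces\<close>

definition inner_on :: "'x set \<Rightarrow> ('x \<Rightarrow> real) \<Rightarrow> ('x \<Rightarrow> real) \<Rightarrow> real" where
  "inner_on X g h = (\<Sum>x\<in>X. g x * h x)"

lemma inner_on_commute: "inner_on X g h = inner_on X h g"
  by (simp add: inner_on_def mult.commute)

lemma inner_on_add_left: "inner_on X (\<lambda>x. g x + g' x) h = inner_on X g h + inner_on X g' h"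
  and inner_on_diff_left: "inner_on X (\<lambda>x. g x - g' x) h = inner_on X g h - inner_on X g' h"
  and inner_on_scale_left: "inner_on X (\<lambda>x. c * g x) h = c * inner_on X g h"
  by (simp_all add: inner_on_def sum.distrib sum_subtractf algebra_simps sum_distrib_left)

lemma inner_on_sum_left:
  "inner_on X (\<lambda>x. \<Sum>i\<in>I. G i x) h = (\<Sum>i\<in>I. inner_on X (G i) h)"
  unfolding inner_on_def sum_distrib_right by (rule sum.swap)

lemma inner_on_add_right: "inner_on X h (\<lambda>x. g x + g' x) = inner_on X h g + inner_on X h g'"
  and inner_on_diff_right: "inner_on X h (\<lambda>x. g x - g' x) = inner_on X h g - inner_on X h g'"
  and inner_on_scale_right: "inner_on X h (\<lambda>x. c * g x) = c * inner_on X h g"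
  and inner_on_sum_right: "inner_on X h (\<lambda>x. \<Sum>i\<in>I. G i x) = (\<Sum>i\<in>I. inner_on X h (G i))"
  by (simp_all add: inner_on_commute[of X h] inner_on_add_left inner_on_diff_left
      inner_on_scale_left inner_on_sum_left)

lemma inner_on_cong:
  "(\<And>x. x \<in> X \<Longrightarrow> g x = g' x) \<Longrightarrow> (\<And>x. x \<in> X \<Longrightarrow> h x = h' x) \<Longrightarrow> inner_on X g h = inner_on X g' h'"
  unfolding inner_on_def by (rule sum.cong) simp_all

lemma inner_on_self_nonneg: "inner_on X g g \<ge> 0"
  by (simp add: inner_on_def sum_nonneg)

lemma inner_on_self_eq_0: "finite X \<Longrightarrow> inner_on X g g = 0 \<longleftrightarrow> (\<forall>x\<in>X. g x = 0)"
  unfolding inner_on_def by (subst sum_nonneg_eq_0_iff) auto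

text \<open>Every function on a finite set has an orthogonal projection to the span of finitely many
  functions. Gram-Schmidt in induction form: adding \<open>b i0\<close> to the family means correcting by its part
  \<open>b'\<close> orthogonal to the others. If \<open>b' = 0\<close>, then the division by zero makes the coefficient \<open>0\<close>, and
  there is nothing to correct.\<close>

lemma orthogonal_projection:
  assumes "finite X" "finite I"
  shows "\<exists>c. \<forall>i\<in>I. inner_on X (\<lambda>x. f x - (\<Sum>j\<in>I. c j * b j x)) (b i) = 0"
  using assms(2)
proof (induction I arbitrary: f)
  case (insert i0 I)
  obtain e where e: "\<And>i. i \<in> I \<Longrightarrow> inner_on X (\<lambda>x. b i0 x - (\<Sum>j\<in>I. e j * b j x)) (b i) = 0"
    using insert.IH[of "b i0"] by blast
  obtain d where d: "\<And>i. i \<in> I \<Longrightarrow> inner_on X (\<lambda>x. f x - (\<Sum>j\<in>I. d j * b j x)) (b i) = 0"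
    using insert.IH[of f] by blast
  define b' f' where "b' = (\<lambda>x. b i0 x - (\<Sum>j\<in>I. e j * b j x))"
    and "f' = (\<lambda>x. f x - (\<Sum>j\<in>I. d j * b j x))"
  define l where "l = inner_on X f' b' / inner_on X b' b'"
  define c where "c = (\<lambda>j. if j = i0 then l else d j - l * e j)"
  define g where "g = (\<lambda>x. f' x - l * b' x)"
  have "(\<Sum>j\<in>insert i0 I. c j * b j x) = (\<Sum>j\<in>I. d j * b j x) + l * b' x" for x
  proof -
    have "(\<Sum>j\<in>I. c j * b j x) = (\<Sum>j\<in>I. (d j - l * e j) * b j x)"
      using insert.hyps by (intro sum.cong) (auto simp: c_def)
    then show ?thesis
      using insert.hyps
      by (simp add: c_def b'_def algebra_simps sum_subtractf sum_distrib_left)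
  qed
  then have g: "(\<lambda>x. f x - (\<Sum>j\<in>insert i0 I. c j * b j x)) = g"
    by (simp add: g_def f'_def fun_eq_iff)
  have gI: "inner_on X g (b i) = 0" if "i \<in> I" for i
    using d[OF that] e[OF that]
    by (simp add: g_def inner_on_diff_left inner_on_scale_left flip: b'_def f'_def)
  have gb': "inner_on X g b' = 0"
  proof (cases "inner_on X b' b' = 0")
    case True
    then have "\<forall>x\<in>X. b' x = 0"
      using inner_on_self_eq_0[OF assms(1)] by blast
    then show ?thesis by (simp add: inner_on_def)
  next
    case False
    then have "inner_on X f' b' = l * inner_on X b' b'"
      by (simp add: l_def)
    then show ?thesis
      by (simp only: g_def inner_on_diff_left inner_on_scale_left)
  qed
  have "inner_on X g (b i0) = inner_on X g (\<lambda>x. b' x + (\<Sum>j\<in>I. e j * b j x))"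
    by (rule inner_on_cong) (simp_all add: b'_def)
  also have "\<dots> = inner_on X g b' + (\<Sum>j\<in>I. e j * inner_on X g (b j))"
    by (simp only: inner_on_add_right inner_on_sum_right inner_on_scale_right)
  finally have "inner_on X g (b i0) = 0"
    using gb' gI by simp
  then have "\<forall>i\<in>insert i0 I. inner_on X g (b i) = 0"
    using gI by blast
  then show ?case
    by (intro exI[of _ c]) (simp only: g)
qed simp

context finite_field_vector_space
begin

text \<open>The adjacency operator of the \<open>q\<close>-Kneser graph, whose edges are the pairs of \<open>k\<close>-subspaces with
  trivial intersection.\<close>

definition kneser :: "nat \<Rightarrow> ('v set \<Rightarrow> real) \<Rightarrow> 'v set \<Rightarrow> real" where
  "kneser k g S = (\<Sum>S'\<in>{S' \<in> Gr scale k UNIV. S' \<inter> S = {0}}. g S')"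

definition subspaces_upto :: "nat \<Rightarrow> 'v set set" where
  "subspaces_upto j = {T. subspace T \<and> dim T \<le> j}"

definition incidence :: "'v set \<Rightarrow> 'v set \<Rightarrow> real" where
  "incidence T S = of_bool (T \<subseteq> S)"

text \<open>The span of the incidence functions of subspaces of dimension at most \<open>j\<close>. Membership refers only
  to values at \<open>k\<close>-subspaces. These spaces increase with \<open>j\<close> and exhaust all functions at
  \<open>j = k\<close> (\<open>level_top\<close>), because a \<open>k\<close>-subspace contains no other \<open>k\<close>-subspace.\<close>

definition level :: "nat \<Rightarrow> nat \<Rightarrow> ('v set \<Rightarrow> real) set" where
  "level k j = {g. \<exists>a. \<forall>S\<in>Gr scale k UNIV. g S = (\<Sum>T\<in>subspaces_upto j. a T * incidence T S)}"

text \<open>The number of \<open>k\<close>-subspaces that contain a given \<open>j\<close>-subspace and avoid a given \<open>k\<close>-subspace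
  disjoint from it.\<close>

definition kneser_deg :: "nat \<Rightarrow> nat \<Rightarrow> real" where
  "kneser_deg k j = real q ^ (k * (k - j)) * gauss_coeff q (dim (UNIV :: 'v set) - k - j) (k - j)"

lemma kneser_scale: "kneser k (\<lambda>S. c * g S) S = c * kneser k g S"
  unfolding kneser_def by (rule sum_distrib_left[symmetric])

lemma kneser_diff: "kneser k (\<lambda>S. g S - h S) S = kneser k g S - kneser k h S"
  unfolding kneser_def by (rule sum_subtractf)

lemma kneser_sum: "kneser k (\<lambda>S. \<Sum>i\<in>I. G i S) S = (\<Sum>i\<in>I. kneser k (G i) S)"
  unfolding kneser_def by (rule sum.swap)

lemma kneser_cong: "(\<And>S. S \<in> Gr scale k UNIV \<Longrightarrow> g S = h S) \<Longrightarrow> kneser k g S = kneser k h S"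
  unfolding kneser_def by (rule sum.cong) simp_all

lemma kneser_symmetric:
  "inner_on (Gr scale k UNIV) (kneser k g) h = inner_on (Gr scale k UNIV) g (kneser k h)"
proof -
  have "inner_on (Gr scale k UNIV) (kneser k g) h
      = (\<Sum>S\<in>Gr scale k UNIV. \<Sum>S'\<in>{S' \<in> Gr scale k UNIV. S' \<inter> S = {0}}. g S' * h S)"
    by (simp add: inner_on_def kneser_def sum_distrib_right)
  also have "\<dots> = (\<Sum>S'\<in>Gr scale k UNIV. \<Sum>S\<in>{S \<in> Gr scale k UNIV. S' \<inter> S = {0}}. g S' * h S)"
    by (rule sum.swap_restrict) auto
  also have "\<dots> = inner_on (Gr scale k UNIV) g (kneser k h)"
    by (simp add: inner_on_def kneser_def sum_distrib_left Int_commute)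
  finally show ?thesis .
qed

lemma levelI:
  "(\<And>S. S \<in> Gr scale k UNIV \<Longrightarrow> g S = (\<Sum>T\<in>subspaces_upto j. a T * incidence T S)) \<Longrightarrow> g \<in> level k j"
  by (auto simp: level_def)

lemma level_combine:
  assumes "g \<in> level k j" "h \<in> level k j"
  shows "(\<lambda>S. c * g S + d * h S) \<in> level k j"
proof -
  obtain a b where "\<forall>S\<in>Gr scale k UNIV. g S = (\<Sum>T\<in>subspaces_upto j. a T * incidence T S)"
    "\<forall>S\<in>Gr scale k UNIV. h S = (\<Sum>T\<in>subspaces_upto j. b T * incidence T S)"
    using assms by (auto simp: level_def)
  then show ?thesis
    by (intro levelI[where a = "\<lambda>T. c * a T + d * b T"])
      (simp add: algebra_simps sum.distrib sum_distrib_left)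
qed

lemma level_cong: "g \<in> level k j \<Longrightarrow> (\<And>S. S \<in> Gr scale k UNIV \<Longrightarrow> h S = g S) \<Longrightarrow> h \<in> level k j"
  by (simp add: level_def)

lemma level_zero: "(\<lambda>_. 0) \<in> level k j"
  by (rule levelI[where a = "\<lambda>_. 0"]) simp

lemma level_scale: "g \<in> level k j \<Longrightarrow> (\<lambda>S. c * g S) \<in> level k j"
  using level_combine[of g k j g c 0] by simp

lemma level_add: "g \<in> level k j \<Longrightarrow> h \<in> level k j \<Longrightarrow> (\<lambda>S. g S + h S) \<in> level k j"
  using level_combine[of g k j h 1 1] by simp

lemma level_diff: "g \<in> level k j \<Longrightarrow> h \<in> level k j \<Longrightarrow> (\<lambda>S. g S - h S) \<in> level k j"
  using level_combine[of g k j h 1 "-1"] by simp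

lemma level_sum: "(\<And>i. i \<in> I \<Longrightarrow> G i \<in> level k j) \<Longrightarrow> (\<lambda>S. \<Sum>i\<in>I. G i S) \<in> level k j"
proof (induction I rule: infinite_finite_induct)
  case (insert i I)
  then have "(\<lambda>S. G i S + (\<Sum>i\<in>I. G i S)) \<in> level k j"
    by (intro level_add) simp_all
  then show ?case
    using insert.hyps by simp
qed (simp_all add: level_zero)

lemma incidence_in_level:
  assumes "subspace T" "dim T \<le> j"
  shows "incidence T \<in> level k j"
proof -
  have "T \<in> subspaces_upto j" using assms by (simp add: subspaces_upto_def)
  then have "incidence T S = (\<Sum>U\<in>subspaces_upto j. of_bool (U = T) * incidence U S)" for S
    by simp
  then show ?thesis
    by (intro levelI[where a = "\<lambda>U. of_bool (U = T)"])
qed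

lemma level_mono:
  assumes "i \<le> j" "g \<in> level k i"
  shows "g \<in> level k j"
proof -
  obtain a where a: "\<And>S. S \<in> Gr scale k UNIV \<Longrightarrow> g S = (\<Sum>T\<in>subspaces_upto i. a T * incidence T S)"
    using assms(2) by (auto simp: level_def)
  have "(\<lambda>S. \<Sum>T\<in>subspaces_upto i. a T * incidence T S) \<in> level k j"
    using assms(1)
    by (intro level_sum level_scale incidence_in_level) (auto simp: subspaces_upto_def)
  then show ?thesis
    using a by (rule level_cong)
qed

lemma level_top: "g \<in> level k k"
proof -
  have "g S = (\<Sum>T\<in>subspaces_upto k. (of_bool (dim T = k) * g T) * incidence T S)"
    if S: "S \<in> Gr scale k UNIV" for S
  proof -
    have "of_bool (dim T = k) * g T * incidence T S = of_bool (T = S) * g S"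
      if "T \<in> subspaces_upto k" for T
    proof (cases "dim T = k \<and> T \<subseteq> S")
      case True
      then have "T = S"
        using that S by (intro subspace_dim_equal) (auto simp: subspaces_upto_def Gr_iff)
      then show ?thesis using True by (simp add: incidence_def)
    next
      case False
      then have "T \<noteq> S" using S by (auto simp: Gr_iff)
      then show ?thesis using False by (auto simp: incidence_def)
    qed
    then have "(\<Sum>T\<in>subspaces_upto k. of_bool (dim T = k) * g T * incidence T S)
        = (\<Sum>T\<in>subspaces_upto k. of_bool (T = S) * g S)"
      by (intro sum.cong) auto
    also have "\<dots> = g S"
      using S by (auto simp: Gr_iff subspaces_upto_def)
    finally show ?thesis by simp
  qed
  then show ?thesis
    by (rule levelI)
qed

text \<open>Moebius inversion: grouping the subspaces by dimension reduces this to the alternating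
  \<open>q\<close>-binomial identity.\<close>

lemma sum_moebius_subspaces:
  assumes "subspace D" "dim D \<le> j"
  shows "(\<Sum>U\<in>{U \<in> subspaces_upto j. U \<subseteq> D}. gauss_moebius q (dim U)) = of_bool (D = {0})"
proof -
  have "(\<Sum>U\<in>{U \<in> subspaces_upto j. U \<subseteq> D}. gauss_moebius q (dim U))
      = (\<Sum>i\<le>dim D. \<Sum>U\<in>{U \<in> {U \<in> subspaces_upto j. U \<subseteq> D}. dim U = i}. gauss_moebius q (dim U))"
    by (rule sum.group[symmetric]) (auto simp: image_subset_iff dim_subset simp del: dim_UNIV)
  also have "\<dots> = (\<Sum>i\<le>dim D. gauss_moebius q i * gauss_coeff q (dim D) i)"
  proof (intro sum.cong refl)
    fix i assume "i \<in> {..dim D}"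
    then have "{U \<in> {U \<in> subspaces_upto j. U \<subseteq> D}. dim U = i} = Gr scale i D"
      using assms(2) by (auto simp: subspaces_upto_def Gr_iff)
    moreover have "(\<Sum>U\<in>Gr scale i D. gauss_moebius q (dim U)) = (\<Sum>U\<in>Gr scale i D. gauss_moebius q i)"
      by (intro sum.cong) (auto simp: Gr_iff)
    ultimately show "(\<Sum>U\<in>{U \<in> {U \<in> subspaces_upto j. U \<subseteq> D}. dim U = i}. gauss_moebius q (dim U))
        = gauss_moebius q i * gauss_coeff q (dim D) i"
      using card_Gr[OF assms(1), of i] by simp
  qed
  also have "\<dots> = of_bool (D = {0})"
    using gauss_moebius_sum[OF q_ge_2, of "dim D"] subspace_0[OF assms(1)] by auto
  finally show ?thesis .
qed

lemma kneser_incidence: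
  assumes "subspace T" "dim T \<le> k" "S \<in> Gr scale k UNIV"
  shows "kneser k (incidence T) S = kneser_deg k (dim T) * of_bool (T \<inter> S = {0})"
proof -
  have S: "subspace S" "dim S = k"
    using assms(3) by (auto simp: Gr_iff)
  have "kneser k (incidence T) S = real (card {U \<in> Gr scale k UNIV. T \<subseteq> U \<and> U \<inter> S = {0}})"
    by (simp add: kneser_def incidence_def of_bool_def sum.If_cases Int_def conj_ac)
  also have "\<dots> = kneser_deg k (dim T) * of_bool (T \<inter> S = {0})"
  proof (cases "T \<inter> S = {0}")
    case True
    then show ?thesis
      using card_extensions_avoiding[of T UNIV S "k - dim T"] assms S by (simp add: kneser_deg_def)
  next
    case False
    then have "{U \<in> Gr scale k UNIV. T \<subseteq> U \<and> U \<inter> S = {0}} = {}"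
      using subspace_0[OF assms(1)] subspace_0[OF S(1)] by blast
    then show ?thesis
      using False by simp
  qed
  finally show ?thesis .
qed

text \<open>Applying \<open>kneser\<close> to an incidence function gives a multiple of the indicator of \<open>T \<inter> S = {0}\<close>.
  Moebius inversion rewrites this indicator through incidence functions of the subspaces of \<open>T\<close>,
  among which \<open>T\<close> itself has the coefficient that becomes the eigenvalue.\<close>

lemma kneser_incidence_moebius:
  assumes "subspace T" "dim T \<le> k" "S \<in> Gr scale k UNIV"
  shows "kneser k (incidence T) S
    = (\<Sum>U\<in>{U. subspace U \<and> U \<subseteq> T}. kneser_deg k (dim T) * gauss_moebius q (dim U) * incidence U S)"
proof -
  have S: "subspace S" using assms(3) by (auto simp: Gr_iff)
  have "{U \<in> subspaces_upto (dim T). U \<subseteq> T \<inter> S} = {U \<in> {U. subspace U \<and> U \<subseteq> T}. U \<subseteq> S}"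
    by (auto simp: subspaces_upto_def dim_subset)
  then have "of_bool (T \<inter> S = {0})
      = (\<Sum>U\<in>{U \<in> {U. subspace U \<and> U \<subseteq> T}. U \<subseteq> S}. gauss_moebius q (dim U))"
    using sum_moebius_subspaces[of "T \<inter> S" "dim T"] assms(1) S by (simp add: subspace_inter dim_subset)
  also have "\<dots> = (\<Sum>U\<in>{U. subspace U \<and> U \<subseteq> T}. gauss_moebius q (dim U) * incidence U S)"
  proof -
    have "(\<Sum>U\<in>{U \<in> {U. subspace U \<and> U \<subseteq> T}. U \<subseteq> S}. gauss_moebius q (dim U))
        = (\<Sum>U\<in>{U. subspace U \<and> U \<subseteq> T}. if U \<subseteq> S then gauss_moebius q (dim U) else 0)"
      by (rule sum.inter_filter) auto
    also have "\<dots> = (\<Sum>U\<in>{U. subspace U \<and> U \<subseteq> T}. gauss_moebius q (dim U) * incidence U S)"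
      by (intro sum.cong) (auto simp: incidence_def)
    finally show ?thesis .
  qed
  finally show ?thesis
    unfolding kneser_incidence[OF assms] by (simp add: sum_distrib_left mult.assoc)
qed

lemma kneser_incidence_level:
  assumes "subspace T" "dim T \<le> k"
  shows "kneser k (incidence T) \<in> level k (dim T)"
proof -
  have "(\<lambda>S. \<Sum>U\<in>{U. subspace U \<and> U \<subseteq> T}. kneser_deg k (dim T) * gauss_moebius q (dim U) * incidence U S)
      \<in> level k (dim T)"
    by (intro level_sum level_scale incidence_in_level) (auto simp: dim_subset)
  then show ?thesis
    by (rule level_cong) (rule kneser_incidence_moebius[OF assms])
qed

lemma kneser_incidence_top:
  assumes "subspace T" "dim T = Suc j" "Suc j \<le> k"
  shows "(\<lambda>S. kneser k (incidence T) S
    - kneser_deg k (Suc j) * gauss_moebius q (Suc j) * incidence T S) \<in> level k j"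
proof -
  let ?U = "{U. subspace U \<and> U \<subseteq> T}"
  have "(\<lambda>S. \<Sum>U\<in>?U - {T}. kneser_deg k (Suc j) * gauss_moebius q (dim U) * incidence U S) \<in> level k j"
  proof (intro level_sum level_scale incidence_in_level)
    fix U assume U: "U \<in> ?U - {T}"
    then show "dim U \<le> j"
      using subspace_dim_equal[of U T] assms by fastforce
  qed auto
  then show ?thesis
  proof (rule level_cong)
    fix S :: "'v set" assume "S \<in> Gr scale k UNIV"
    then show "kneser k (incidence T) S - kneser_deg k (Suc j) * gauss_moebius q (Suc j) * incidence T S
        = (\<Sum>U\<in>?U - {T}. kneser_deg k (Suc j) * gauss_moebius q (dim U) * incidence U S)"
      using kneser_incidence_moebius[of T k S] assms by (simp add: sum_diff1 del: gauss_moebius.simps)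
  qed
qed

text \<open>Modulo \<open>level k j\<close>, the operator acts on \<open>level k (Suc j)\<close> as a scalar. Since it is also symmetric
  and preserves every level, it acts as this scalar on the orthogonal complement of one level in
  the next, as far as quadratic forms are concerned.\<close>

lemma kneser_triangular:
  assumes "g \<in> level k (Suc j)" "Suc j \<le> k"
  shows "(\<lambda>S. kneser k g S - kneser_deg k (Suc j) * gauss_moebius q (Suc j) * g S) \<in> level k j"
proof -
  define l where "l = kneser_deg k (Suc j) * gauss_moebius q (Suc j)"
  obtain a where a: "\<And>S. S \<in> Gr scale k UNIV \<Longrightarrow> g S = (\<Sum>T\<in>subspaces_upto (Suc j). a T * incidence T S)"
    using assms(1) by (auto simp: level_def)
  have "(\<lambda>S. kneser k (incidence T) S - l * incidence T S) \<in> level k j" if "T \<in> subspaces_upto (Suc j)" for T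
  proof (cases "dim T = Suc j")
    case True
    then show ?thesis
      using kneser_incidence_top[of T j k] that assms(2) by (simp add: subspaces_upto_def l_def)
  next
    case False
    then have T: "subspace T" "dim T \<le> j" "dim T \<le> k"
      using that assms(2) by (auto simp: subspaces_upto_def)
    then show ?thesis
      by (intro level_diff level_scale incidence_in_level level_mono[OF T(2)] kneser_incidence_level)
  qed
  then have "(\<lambda>S. \<Sum>T\<in>subspaces_upto (Suc j). a T * (kneser k (incidence T) S - l * incidence T S)) \<in> level k j"
    by (intro level_sum level_scale)
  then show ?thesis
  proof (rule level_cong)
    fix S :: "'v set" assume S: "S \<in> Gr scale k UNIV"
    have "kneser k g S = (\<Sum>T\<in>subspaces_upto (Suc j). a T * kneser k (incidence T) S)"
    proof -
      have "kneser k g S = kneser k (\<lambda>S. \<Sum>T\<in>subspaces_upto (Suc j). a T * incidence T S) S"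
        by (rule kneser_cong) (rule a)
      then show ?thesis by (simp only: kneser_sum kneser_scale)
    qed
    then show "kneser k g S - kneser_deg k (Suc j) * gauss_moebius q (Suc j) * g S
        = (\<Sum>T\<in>subspaces_upto (Suc j). a T * (kneser k (incidence T) S - l * incidence T S))"
      unfolding a[OF S] by (simp add: l_def algebra_simps sum_subtractf sum_distrib_left sum.distrib del: gauss_moebius.simps)
  qed
qed

lemma kneser_level:
  assumes "g \<in> level k j" "j \<le> k"
  shows "kneser k g \<in> level k j"
proof -
  obtain a where a: "\<And>S. S \<in> Gr scale k UNIV \<Longrightarrow> g S = (\<Sum>T\<in>subspaces_upto j. a T * incidence T S)"
    using assms(1) by (auto simp: level_def)
  have "(\<lambda>S. \<Sum>T\<in>subspaces_upto j. a T * kneser k (incidence T) S) \<in> level k j"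
  proof (intro level_sum level_scale)
    fix T assume "T \<in> subspaces_upto j"
    then have T: "subspace T" "dim T \<le> j" "dim T \<le> k"
      using assms(2) by (auto simp: subspaces_upto_def)
    show "kneser k (incidence T) \<in> level k j"
      by (rule level_mono[OF T(2) kneser_incidence_level[OF T(1,3)]])
  qed
  then show ?thesis
  proof (rule level_cong)
    fix S :: "'v set"
    have "kneser k g S = kneser k (\<lambda>S. \<Sum>T\<in>subspaces_upto j. a T * incidence T S) S"
      by (rule kneser_cong) (rule a)
    then show "kneser k g S = (\<Sum>T\<in>subspaces_upto j. a T * kneser k (incidence T) S)"
      by (simp only: kneser_sum kneser_scale)
  qed
qed

end

context finite_field_vector_space
begin

lemma kneser_deg_Suc:
  assumes "j < k" "2 * k < dim (UNIV :: 'v set)"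
  shows "kneser_deg k j * qint q (k - j)
    = real q ^ k * qint q (dim (UNIV :: 'v set) - k - j) * kneser_deg k (Suc j)"
proof -
  obtain a b where "dim (UNIV :: 'v set) - k - j = Suc a" "k - j = Suc b"
    using assms by (metis Suc_diff_Suc add.commute diff_diff_left add_less_cancel_right less_trans mult_2 zero_less_diff Suc_pred)
  moreover from this have "dim (UNIV :: 'v set) - k - Suc j = a" "k - Suc j = b"
    by simp_all
  ultimately show ?thesis
    using gauss_coeff_Suc_Suc[OF q_ge_2, of a b] by (simp add: kneser_deg_def power_add)
qed

lemma kneser_deg_pos:
  assumes "2 * k < dim (UNIV :: 'v set)"
  shows "kneser_deg k j > 0"
  using assms q_ge_2 unfolding kneser_deg_def by (intro mult_pos_pos gauss_coeff_pos) auto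

text \<open>Each step from \<open>j\<close> to \<open>j + 1\<close> multiplies the absolute eigenvalue by
  \<open>q^j [k - j] / (q^k [n - k - j])\<close>, which is at most \<open>1 / 2\<close> as \<open>[n - k - j] \<ge> [k - j + 1] \<ge> q [k - j]\<close>.\<close>

lemma kneser_eigenvalue_bound:
  assumes "2 * k < dim (UNIV :: 'v set)" "1 \<le> j" "Suc j \<le> k"
  shows "kneser_deg k (Suc j) * \<bar>gauss_moebius q (Suc j)\<bar> \<le> kneser_deg k 1 / 2"
proof -
  have step: "kneser_deg k (Suc j) * \<bar>gauss_moebius q (Suc j)\<bar> \<le> kneser_deg k j * \<bar>gauss_moebius q j\<bar> / 2"
    if j: "Suc j \<le> k" for j
  proof -
    define n where "n = dim (UNIV :: 'v set)"
    have q: "real q \<ge> 2" using q_ge_2 by simp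
    have "k - j + 1 \<le> n - k - j"
      using assms(1) j unfolding n_def by linarith
    have "2 * qint q (k - j) \<le> real q * qint q (k - j)"
      using q by (intro mult_right_mono) auto
    also have "\<dots> \<le> qint q (Suc (k - j))"
      by (simp add: qint_Suc')
    also have "\<dots> \<le> qint q (n - k - j)"
      using \<open>k - j + 1 \<le> n - k - j\<close> by (intro qint_mono) simp
    finally have le: "2 * qint q (k - j) \<le> qint q (n - k - j)" .
    have "real q ^ j \<le> real q ^ k"
      using q j by (intro power_increasing) auto
    then have "2 * qint q (k - j) * (real q ^ j * kneser_deg k (Suc j))
        \<le> qint q (n - k - j) * (real q ^ k * kneser_deg k (Suc j))"
      using kneser_deg_pos[OF assms(1), of "Suc j"] le by (intro mult_mono) auto
    also have "\<dots> = kneser_deg k j * qint q (k - j)"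
      using kneser_deg_Suc[of j k] j assms(1) by (simp add: n_def)
    finally have "qint q (k - j) * (2 * (real q ^ j * kneser_deg k (Suc j))) \<le> qint q (k - j) * kneser_deg k j"
      by (simp add: mult_ac)
    then have "2 * (real q ^ j * kneser_deg k (Suc j)) \<le> kneser_deg k j"
      using qint_pos[of "k - j" q] j by simp
    then have "2 * (real q ^ j * kneser_deg k (Suc j)) * \<bar>gauss_moebius q j\<bar>
        \<le> kneser_deg k j * \<bar>gauss_moebius q j\<bar>"
      by (intro mult_right_mono) auto
    then show ?thesis
      by (simp add: abs_mult mult_ac)
  qed
  have nonneg: "kneser_deg k j * \<bar>gauss_moebius q j\<bar> \<ge> 0" for j
    using kneser_deg_pos[OF assms(1), of j] by simp
  show ?thesis
    using assms(2,3)
  proof (induction j rule: nat_induct_at_least)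
    case base
    then show ?case
      using step[of 1] by simp
  next
    case (Suc j)
    then show ?case
      using step[of "Suc j"] nonneg[of "Suc j"] by (simp del: gauss_moebius.simps)
  qed
qed

text \<open>Induction on the level. Split \<open>g = a + b\<close> with \<open>a\<close> the projection to the previous level: the
  mixed terms vanish because the operator is symmetric and preserves levels, \<open>a\<close> is covered by
  the induction hypothesis, and \<open>b\<close> contributes the scalar of \<open>kneser_triangular\<close>.\<close>

lemma kneser_lower_bound:
  assumes n: "2 * k < dim (UNIV :: 'v set)" and j: "1 \<le> j" "j \<le> k"
    and g: "g \<in> level k j"
    and orth: "\<And>T. T \<in> subspaces_upto 1 \<Longrightarrow> inner_on (Gr scale k UNIV) g (incidence T) = 0"
  shows "inner_on (Gr scale k UNIV) g (kneser k g)
    \<ge> - (kneser_deg k 1 / 2) * inner_on (Gr scale k UNIV) g g"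
  using j g orth
proof (induction j arbitrary: g rule: nat_induct_at_least)
  let ?X = "Gr scale k (UNIV :: 'v set)"
  have level_orth: "inner_on ?X g h = 0"
    if h: "h \<in> level k i" and o: "\<And>T. T \<in> subspaces_upto i \<Longrightarrow> inner_on ?X g (incidence T) = 0" for g h i
  proof -
    obtain a where a: "\<And>S. S \<in> ?X \<Longrightarrow> h S = (\<Sum>T\<in>subspaces_upto i. a T * incidence T S)"
      using h by (auto simp: level_def)
    have "inner_on ?X g h = inner_on ?X g (\<lambda>S. \<Sum>T\<in>subspaces_upto i. a T * incidence T S)"
      using a by (intro inner_on_cong) auto
    then show ?thesis
      using o by (simp add: inner_on_sum_right inner_on_scale_right)
  qed
  {
    case base
    have "inner_on ?X g g = 0"
      by (rule level_orth[OF base(2)]) (rule base(3))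
    then have "\<forall>S\<in>?X. g S = 0"
      by (subst (asm) inner_on_self_eq_0) auto
    then show ?case
      by (simp add: inner_on_def)
  next
    case (Suc j)
    obtain c where c: "\<And>T. T \<in> subspaces_upto j \<Longrightarrow>
        inner_on ?X (\<lambda>S. g S - (\<Sum>T\<in>subspaces_upto j. c T * incidence T S)) (incidence T) = 0"
      using orthogonal_projection[of ?X "subspaces_upto j" g incidence] by auto
    define a where "a = (\<lambda>S. \<Sum>T\<in>subspaces_upto j. c T * incidence T S)"
    define b where "b = (\<lambda>S. g S - a S)"
    define l where "l = kneser_deg k (Suc j) * gauss_moebius q (Suc j)"
    have a: "a \<in> level k j"
      unfolding a_def by (intro level_sum level_scale incidence_in_level) (auto simp: subspaces_upto_def)
    then have b: "b \<in> level k (Suc j)"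
      unfolding b_def using Suc.prems(2) level_mono[of j "Suc j" a k] by (intro level_diff) auto
    have "inner_on ?X b (incidence T) = 0" if "T \<in> subspaces_upto j" for T
      using c[OF that] by (simp add: b_def a_def)
    then have b_orth: "inner_on ?X b h = 0" if "h \<in> level k j" for h
      using level_orth[OF that] by blast
    have "inner_on ?X a (incidence T) = 0" if T: "T \<in> subspaces_upto 1" for T
    proof -
      have "inner_on ?X g (incidence T) = 0" by (rule Suc.prems(3)[OF T])
      moreover have "inner_on ?X b (incidence T) = 0"
        using T Suc.hyps by (intro b_orth incidence_in_level) (auto simp: subspaces_upto_def)
      ultimately show ?thesis
        by (simp add: b_def inner_on_diff_left)
    qed
    then have IH: "inner_on ?X a (kneser k a) \<ge> - (kneser_deg k 1 / 2) * inner_on ?X a a"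
      using Suc.IH[of a] a Suc.prems(1) by simp
    have ab: "inner_on ?X b a = 0" "inner_on ?X b (kneser k a) = 0"
      using Suc.prems(1) a by (intro b_orth kneser_level; simp)+
    have bb: "inner_on ?X b (kneser k b) = l * inner_on ?X b b"
    proof -
      have "inner_on ?X b (\<lambda>S. kneser k b S - l * b S) = 0"
        unfolding l_def using b Suc.prems(1) by (intro b_orth kneser_triangular)
      then show ?thesis
        by (simp add: inner_on_diff_right inner_on_scale_right)
    qed
    have "\<bar>l\<bar> \<le> kneser_deg k 1 / 2"
      using kneser_eigenvalue_bound[OF n Suc.hyps Suc.prems(1)] kneser_deg_pos[OF n, of "Suc j"]
      by (simp add: l_def abs_mult del: gauss_moebius.simps)
    then have "l * inner_on ?X b b \<ge> - (kneser_deg k 1 / 2) * inner_on ?X b b"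
      by (intro mult_right_mono inner_on_self_nonneg) simp
    moreover have "kneser k g S = kneser k a S + kneser k b S" for S
      unfolding b_def kneser_diff by simp
    then have "inner_on ?X g (kneser k g) = inner_on ?X (\<lambda>S. a S + b S) (\<lambda>S. kneser k a S + kneser k b S)"
      by (intro inner_on_cong) (simp_all add: b_def)
    then have "inner_on ?X g (kneser k g) = inner_on ?X a (kneser k a) + l * inner_on ?X b b"
      using ab bb kneser_symmetric[of k a b] inner_on_commute[of ?X "kneser k a" b]
      by (simp add: inner_on_add_left inner_on_add_right)
    moreover have "inner_on ?X g g = inner_on ?X (\<lambda>S. a S + b S) (\<lambda>S. a S + b S)"
      by (intro inner_on_cong) (simp_all add: b_def)
    then have "inner_on ?X g g = inner_on ?X a a + inner_on ?X b b"
      using ab inner_on_commute[of ?X a b] by (simp add: inner_on_add_left inner_on_add_right)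
    ultimately show ?case
      using IH by (simp only: distrib_left)
  }
qed

end

section \<open>Intersecting families\<close>

context finite_field_vector_space
begin

lemma inner_incidence_points:
  assumes "x \<in> Gr scale 1 UNIV" "y \<in> Gr scale 1 UNIV" "k \<ge> 2"
  shows "inner_on (Gr scale k UNIV) (incidence y) (incidence x)
    = (if x = y then gauss_coeff q (dim (UNIV :: 'v set) - 1) (k - 1)
       else gauss_coeff q (dim (UNIV :: 'v set) - 2) (k - 2))"
proof -
  have "inner_on (Gr scale k UNIV) (incidence y) (incidence x)
      = real (card {F \<in> Gr scale k UNIV. x \<subseteq> F \<and> y \<subseteq> F})"
  proof -
    have "inner_on (Gr scale k UNIV) (incidence y) (incidence x)
        = (\<Sum>F\<in>Gr scale k UNIV. if x \<subseteq> F \<and> y \<subseteq> F then 1 else 0)"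
      unfolding inner_on_def by (rule sum.cong) (auto simp: incidence_def)
    then show ?thesis
      by (simp add: sum.inter_filter[symmetric])
  qed
  then show ?thesis
    using card_containing_point[OF assms(1), of k] card_containing_two_points[OF assms(1,2) _ assms(3)] assms(3)
    by auto
qed

text \<open>The contradiction comes from two evaluations of the disjointness operator \<open>K\<close> on the indicator \<open>f\<close>
  of \<open>\<F>\<close>. With \<open>f = p + r\<close>, where \<open>p\<close> is the projection to the span of the point stars,
  \<open>\<langle>f, K f\<rangle> = 0\<close> yields the bound \<open>hoffman\<close> on \<open>R = |r|\<^sup>2\<close>. Since \<open>K f\<close> is supported on non-members,
  all of degree above \<open>[k] c\<close>, its scalar product with the degree function \<open>h\<close> exceeds \<open>[k] c\<close> times
  its total mass; this is \<open>strict\<close>. As \<open>h\<close> is a combination of point stars, \<open>K h\<close> and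
  \<open>\<Sum>\<^sub>x d(x)\<^sup>2\<close> are explicit, and after division \<open>strict\<close> reads
  \<open>[k] (m - A m) < R\<close> with \<open>m = |\<F>|\<close> and \<open>A = m / C\<close>, while \<open>hoffman\<close> reads \<open>R \<le> 2 (m - A m)\<close>.\<close>

lemma exists_low_degree_if_intersecting:
  fixes n :: nat
  assumes n: "n = dim (UNIV :: 'v set)" and k: "k \<ge> 2" and nk: "2 * k < n"
    and F: "\<F> \<subset> Gr scale k UNIV"
    and int: "\<And>S T. S \<in> \<F> \<Longrightarrow> T \<in> \<F> \<Longrightarrow> S \<inter> T \<noteq> {0}"
  shows "\<exists>S\<in>Gr scale k UNIV - \<F>.
    real (subspace_degree scale \<F> S) \<le> qint q k * gauss_coeff q (n - 2) (k - 2)"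
proof (rule ccontr)
  assume "\<not> ?thesis"
  define c C where "c = gauss_coeff q (n - 2) (k - 2)" and "C = gauss_coeff q (n - 1) (k - 1)"
  let ?X = "Gr scale k (UNIV :: 'v set)" and ?P = "Gr scale 1 (UNIV :: 'v set)"
  let ?K = "kneser_deg k 1" and ?L = "kneser_deg k 0"
  let ?ip = "inner_on ?X"
  from \<open>\<not> ?thesis\<close> have deg: "real (subspace_degree scale \<F> S) > qint q k * c"
    if "S \<in> ?X - \<F>" for S
    using that by (auto simp: c_def not_le)
  have F': "\<F> \<subseteq> ?X" using F by blast
  have nk': "2 * k < dim (UNIV :: 'v set)" using nk n by blast
  have K: "?K > 0" "?L > 0"
    by (intro kneser_deg_pos nk')+
  have cC: "c > 0" "C > 0"
    using q_ge_2 k nk by (auto simp: c_def C_def intro!: gauss_coeff_pos)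
  have qk: "qint q k = 1 + real q * qint q (k - 1)"
    using qint_Suc'[of q "k - 1"] k by simp
  have pascal: "C - c = real q ^ (k - 1) * gauss_coeff q (n - 2) (k - 1)"
    using gauss_coeff_pascal[OF q_ge_2, of "n - 2" "k - 2"] k nk
    by (simp add: c_def C_def Suc_diff_Suc numeral_2_eq_2)
  then have Cc: "C - c > 0"
    using q_ge_2 nk by (auto intro!: mult_pos_pos gauss_coeff_pos)
  \<comment> \<open>Equivalently, a full star gives equality in \<open>strict\<close>; there \<open>m = C\<close> and \<open>R = 0\<close>.\<close>
  have ident: "?L * (qint q k * c) = ?K * ((qint q k - 1) * (C - c))"
  proof -
    have "gauss_coeff q (n - 2) (k - 1) * qint q (k - 1) = qint q (n - k) * c"
      using gauss_coeff_Suc_right[OF q_ge_2, of "n - 2" "k - 2"] k nk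
      by (simp add: c_def Suc_diff_Suc numeral_2_eq_2)
    then have "(qint q k - 1) * (C - c) = real q * real q ^ (k - 1) * (qint q (n - k) * c)"
      unfolding qk pascal by (simp add: algebra_simps)
    also have "real q * real q ^ (k - 1) = real q ^ k"
      using k by (simp flip: power_Suc)
    finally have "?K * ((qint q k - 1) * (C - c)) = (real q ^ k * qint q (n - k) * ?K) * c"
      by (simp add: mult_ac)
    also have "real q ^ k * qint q (n - k) * ?K = ?L * qint q k"
      using kneser_deg_Suc[of 0 k] k nk' n by simp
    finally show ?thesis by (simp add: mult_ac)
  qed

  define f where "f = (\<lambda>S. of_bool (S \<in> \<F>) :: real)"
  define N where "N = kneser k f"
  define d where "d x = real (point_degree \<F> x)" for x
  define m where "m = real (card \<F>)"
  have ip_f: "?ip f h = (\<Sum>S\<in>\<F>. h S)" for h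
  proof -
    have "?ip f h = (\<Sum>S\<in>?X. if S \<in> \<F> then h S else 0)"
      unfolding inner_on_def by (rule sum.cong) (simp_all add: f_def)
    also have "\<dots> = (\<Sum>S\<in>?X \<inter> \<F>. h S)"
      by (rule sum.inter_restrict[symmetric]) simp
    finally show ?thesis using F' by (simp add: Int_absorb1)
  qed
  have N: "N S = real (card {S' \<in> \<F>. S' \<inter> S = {0}})" for S
  proof -
    have "N S = (\<Sum>S'\<in>{S' \<in> ?X. S' \<inter> S = {0}} \<inter> \<F>. 1)"
      by (simp add: N_def kneser_def f_def of_bool_def sum.If_cases)
    moreover have "{S' \<in> ?X. S' \<inter> S = {0}} \<inter> \<F> = {S' \<in> \<F>. S' \<inter> S = {0}}"
      using F' by blast
    ultimately show ?thesis by simp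
  qed
  have N_nonneg: "N S \<ge> 0" for S by (simp add: N)
  have N_F: "N S = 0" if "S \<in> \<F>" for S
  proof -
    have "{S' \<in> \<F>. S' \<inter> S = {0}} = {}" using int that by blast
    then show ?thesis by (simp add: N)
  qed
  \<comment> \<open>The star of a point is mapped to a multiple of its complement, so the eigenvalue is \<open>- ?K\<close>.\<close>
  have K_point: "kneser k (incidence x) S = ?K * (1 - incidence x S)"
    if "x \<in> ?P" "S \<in> ?X" for x S
  proof -
    have x: "subspace x" "dim x = 1" and S: "subspace S" using that by (auto simp: Gr_iff)
    have "x \<inter> S = {0} \<longleftrightarrow> \<not> x \<subseteq> S"
    proof
      assume "x \<inter> S = {0}"
      then show "\<not> x \<subseteq> S" using x(2) dim_eq_0[of x] by (auto simp: Int_absorb2)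
    qed (use point_Int_subspace that(1) S in blast)
    then show ?thesis
      using kneser_incidence[OF x(1) _ that(2)] x(2) k by (simp add: incidence_def)
  qed
  have K_const: "kneser k (\<lambda>_. 1) S = ?L" if "S \<in> ?X" for S
  proof -
    have "kneser k (incidence {0}) S = ?L"
      using kneser_incidence[of "{0}" k S] that subspace_0 by (auto simp: Gr_iff)
    moreover have "kneser k (incidence {0}) S = kneser k (\<lambda>_. 1) S"
      by (rule kneser_cong) (auto simp: incidence_def Gr_iff subspace_0)
    ultimately show ?thesis by simp
  qed
  have sum_N: "(\<Sum>S\<in>?X. N S) = ?L * m"
  proof -
    have "(\<Sum>S\<in>?X. N S) = ?ip N (\<lambda>_. 1)" by (simp add: inner_on_def)
    also have "\<dots> = ?ip f (kneser k (\<lambda>_. 1))" unfolding N_def by (rule kneser_symmetric)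
    also have "\<dots> = (\<Sum>S\<in>\<F>. ?L)"
      unfolding ip_f using K_const F' by (intro sum.cong) auto
    finally show ?thesis by (simp add: m_def)
  qed
  define h where "h = (\<lambda>S. \<Sum>x\<in>?P. d x * incidence x S)"
  have h_deg: "h S = real (subspace_degree scale \<F> S)" for S
  proof -
    have "(\<Sum>x\<in>{x \<in> ?P. x \<subseteq> S}. d x) = (\<Sum>x\<in>?P. if x \<subseteq> S then d x else 0)"
      by (rule sum.inter_filter) simp
    also have "\<dots> = h S"
      unfolding h_def by (rule sum.cong) (simp_all add: incidence_def)
    finally show ?thesis
      by (simp add: subspace_degree_def d_def flip: Gr_eq_restrict)
  qed
  have sum_d: "(\<Sum>x\<in>?P. d x) = qint q k * m"
    unfolding d_def m_def by (rule sum_point_degree[OF F'])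
  have sum_Fh: "(\<Sum>S\<in>\<F>. h S) = (\<Sum>x\<in>?P. d x * d x)"
    unfolding h_deg d_def by (rule sum_subspace_degree[OF F'])
  have sum_Nh: "(\<Sum>S\<in>?X. N S * h S) = ?K * (qint q k * m * m - (\<Sum>x\<in>?P. d x * d x))"
  proof -
    have "(\<Sum>S\<in>?X. N S * h S) = ?ip f (kneser k h)"
      using kneser_symmetric[of k f h] by (simp add: inner_on_def N_def)
    also have "\<dots> = (\<Sum>S\<in>\<F>. ?K * (qint q k * m - h S))"
      unfolding ip_f
    proof (intro sum.cong refl)
      fix S assume "S \<in> \<F>"
      then have S: "S \<in> ?X" using F' by blast
      have "kneser k h S = (\<Sum>x\<in>?P. d x * kneser k (incidence x) S)"
        unfolding h_def kneser_sum kneser_scale ..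
      also have "\<dots> = (\<Sum>x\<in>?P. ?K * (d x - d x * incidence x S))"
        using S by (intro sum.cong refl) (simp add: K_point right_diff_distrib)
      finally show "kneser k h S = ?K * (qint q k * m - h S)"
        by (simp only: h_def sum_subtractf sum_d flip: sum_distrib_left)
    qed
    also have "\<dots> = ?K * ((\<Sum>S\<in>\<F>. qint q k * m) - (\<Sum>S\<in>\<F>. h S))"
      by (simp only: sum_subtractf flip: sum_distrib_left)
    finally show ?thesis
      unfolding sum_Fh by (simp add: m_def mult_ac)
  qed
  have "\<F> \<noteq> {}"
  proof
    assume "\<F> = {}"
    moreover obtain S where "S \<in> ?X - \<F>" using F by blast
    ultimately show False
      using deg[of S] mult_nonneg_nonneg[OF qint_nonneg less_imp_le[OF cC(1)], of q k]
      by (simp add: subspace_degree_def point_degree_def)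
  qed
  then have m: "m > 0"
    by (simp add: m_def card_gt_0_iff)
  have strict: "?L * (qint q k * c) * m < ?K * (qint q k * m * m - (\<Sum>x\<in>?P. d x * d x))"
  proof -
    have "0 < (\<Sum>S\<in>?X. N S)" using sum_N K m by simp
    then have "\<not> (\<forall>S\<in>?X. N S \<le> 0)"
      using sum_nonpos[of ?X N] by fastforce
    then obtain S0 where S0: "S0 \<in> ?X" "N S0 > 0"
      by (auto simp: not_le)
    have "(\<Sum>S\<in>?X. N S * (qint q k * c)) < (\<Sum>S\<in>?X. N S * h S)"
    proof (rule sum_strict_mono_ex1)
      show "\<forall>S\<in>?X. N S * (qint q k * c) \<le> N S * h S"
      proof
        fix S assume "S \<in> ?X"
        then show "N S * (qint q k * c) \<le> N S * h S"
          using N_F[of S] N_nonneg[of S] deg[of S] by (cases "S \<in> \<F>") (auto simp: h_deg intro: mult_left_mono)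
      qed
      have "S0 \<notin> \<F>" using S0 N_F[of S0] by auto
      then show "\<exists>S\<in>?X. N S * (qint q k * c) < N S * h S"
        using S0 deg[of S0] by (auto simp: h_deg intro!: bexI[of _ S0])
    qed simp
    then show ?thesis
      unfolding sum_Nh sum_distrib_right[symmetric] sum_N by (simp only: mult_ac)
  qed

  obtain a where a: "\<And>x. x \<in> ?P \<Longrightarrow>
      ?ip (\<lambda>S. f S - (\<Sum>y\<in>?P. a y * incidence y S)) (incidence x) = 0"
    using orthogonal_projection[of ?X ?P f incidence] by auto
  define p r where "p = (\<lambda>S. \<Sum>y\<in>?P. a y * incidence y S)" and "r = (\<lambda>S. f S - p S)"
  define A R where "A = (\<Sum>x\<in>?P. a x)" and "R = ?ip r r"
  have r_point: "?ip r (incidence x) = 0" if "x \<in> ?P" for x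
    using a[OF that] by (simp add: r_def p_def)
  have points_const: "(\<Sum>x\<in>?P. incidence x S) = qint q k" if "S \<in> ?X" for S
    using card_points[of S] that
    by (simp add: incidence_def Gr_eq_restrict[of 1 S] GrD Int_def del: One_nat_def)
  have r_1: "?ip r (\<lambda>_. 1) = 0"
  proof -
    have "qint q k * ?ip r (\<lambda>_. 1) = ?ip r (\<lambda>S. \<Sum>x\<in>?P. incidence x S)"
      using points_const by (simp add: inner_on_def sum_distrib_left mult_ac)
    also have "\<dots> = 0"
      by (simp add: inner_on_sum_right r_point)
    finally show ?thesis using qint_pos[of k q] k by simp
  qed
  have rp: "?ip r p = 0"
    unfolding p_def by (simp add: inner_on_sum_right inner_on_scale_right r_point)
  have f_eq: "f = (\<lambda>S. p S + r S)" by (simp add: r_def)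
  have ff: "?ip f f = m"
    unfolding ip_f by (simp add: f_def m_def)
  have f1: "?ip f (\<lambda>_. 1) = m"
    unfolding ip_f by (simp add: m_def)
  have pp: "?ip p p = m - R" and fp: "?ip f p = m - R"
  proof -
    have "?ip f f = ?ip p p + R"
      using rp inner_on_commute[of ?X p r] unfolding f_eq R_def
      by (simp add: inner_on_add_left inner_on_add_right)
    then show "?ip p p = m - R" using ff by simp
    then show "?ip f p = m - R"
      using rp unfolding f_eq by (simp add: inner_on_add_left)
  qed
  have p1: "?ip p (\<lambda>_. 1) = m"
    using f1 r_1 unfolding f_eq by (simp add: inner_on_add_left)
  have AC: "A * C = m"
  proof -
    have "?ip (incidence x) (\<lambda>_. 1) = C" if "x \<in> ?P" for x
      using card_containing_point[OF that, of k] k n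
      by (simp add: inner_on_def incidence_def C_def Int_def)
    then have "?ip p (\<lambda>_. 1) = (\<Sum>x\<in>?P. a x * C)"
      unfolding p_def inner_on_sum_left inner_on_scale_left by (intro sum.cong) auto
    then show ?thesis
      using p1 by (simp add: A_def sum_distrib_right)
  qed
  have Kp: "kneser k p S = ?K * (A - p S)" if "S \<in> ?X" for S
  proof -
    have "kneser k p S = (\<Sum>x\<in>?P. a x * kneser k (incidence x) S)"
      unfolding p_def kneser_sum kneser_scale ..
    also have "\<dots> = (\<Sum>x\<in>?P. ?K * (a x - a x * incidence x S))"
      using that by (intro sum.cong refl) (simp add: K_point right_diff_distrib)
    finally show ?thesis
      by (simp only: p_def A_def sum_subtractf flip: sum_distrib_left)
  qed
  have ip_Kp: "?ip g (kneser k p) = ?K * (A * ?ip g (\<lambda>_. 1) - ?ip g p)" for g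
  proof -
    have "?ip g (kneser k p) = ?ip g (\<lambda>S. ?K * (A * 1 - p S))"
      using Kp by (intro inner_on_cong) auto
    then show ?thesis
      by (simp only: inner_on_scale_right inner_on_diff_right)
  qed
  have "?ip r (kneser k r) \<ge> - (?K / 2) * R"
    unfolding R_def
  proof (rule kneser_lower_bound[OF nk' _ order_refl level_top])
    fix T assume T: "T \<in> subspaces_upto 1"
    then consider "T = {0}" | "T \<in> ?P"
      using subspace_0[of T] dim_eq_0[of T] by (fastforce simp: subspaces_upto_def Gr_iff le_Suc_eq)
    then show "?ip r (incidence T) = 0"
    proof cases
      case 1
      have "?ip r (incidence T) = ?ip r (\<lambda>_. 1)"
        using 1 by (intro inner_on_cong) (auto simp: incidence_def Gr_iff subspace_0)
      then show ?thesis using r_1 by simp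
    qed (rule r_point)
  qed (use k in simp)
  moreover have "?ip f N = 0"
    unfolding ip_f by (simp add: N_F)
  moreover have "?ip f N = ?ip p (kneser k p) + ?ip r (kneser k r)"
  proof -
    have "?ip f N = ?ip (\<lambda>S. p S + r S) (\<lambda>S. kneser k p S + kneser k r S)"
      unfolding N_def by (rule inner_on_cong) (simp_all add: r_def kneser_diff)
    also have "\<dots> = ?ip p (kneser k p) + ?ip r (kneser k r) + ?ip r (kneser k p) + ?ip p (kneser k r)"
      by (simp add: inner_on_add_left inner_on_add_right)
    also have "?ip p (kneser k r) = ?ip r (kneser k p)"
      by (metis inner_on_commute kneser_symmetric)
    also have "?ip r (kneser k p) = 0"
      unfolding ip_Kp by (simp add: r_1 rp)
    finally show ?thesis by simp
  qed
  ultimately have "?K * (A * m - (m - R)) - ?K / 2 * R \<le> 0"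
    by (simp add: ip_Kp p1 pp)
  then have "?K * (A * m - m + R / 2) \<le> 0"
    by (simp add: algebra_simps)
  then have hoffman: "A * m - m + R / 2 \<le> 0"
    using K(1) by (simp add: mult_le_0_iff)

  have d_eq: "d x = (C - c) * a x + c * A" if x: "x \<in> ?P" for x
  proof -
    have "d x = ?ip f (incidence x)"
      unfolding ip_f by (simp add: d_def point_degree_def incidence_def Int_def)
    also have "\<dots> = ?ip p (incidence x)"
      using r_point[OF x] unfolding f_eq by (simp add: inner_on_add_left)
    also have "\<dots> = (\<Sum>y\<in>?P. a y * ?ip (incidence y) (incidence x))"
      unfolding p_def inner_on_sum_left inner_on_scale_left ..
    also have "\<dots> = (\<Sum>y\<in>?P. (if y = x then (C - c) * a y else 0) + c * a y)"
      using inner_incidence_points[OF x _ k] n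
      by (intro sum.cong) (auto simp: C_def c_def algebra_simps)
    also have "\<dots> = (C - c) * a x + c * A"
      using x by (simp add: sum.distrib A_def sum_distrib_left[symmetric])
    finally show ?thesis .
  qed
  have "(\<Sum>x\<in>?P. a x * d x) = m - R"
  proof -
    have "?ip f p = (\<Sum>x\<in>?P. a x * ?ip f (incidence x))"
      unfolding p_def inner_on_sum_right inner_on_scale_right ..
    also have "\<dots> = (\<Sum>x\<in>?P. a x * d x)"
      unfolding ip_f by (simp add: d_def point_degree_def incidence_def Int_def)
    finally show ?thesis using fp by simp
  qed
  moreover have "(\<Sum>x\<in>?P. d x * d x) = (\<Sum>x\<in>?P. (C - c) * (a x * d x) + c * A * d x)"
  proof (intro sum.cong refl)
    fix x assume "x \<in> ?P"
    then have "d x * d x = ((C - c) * a x + c * A) * d x"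
      using d_eq[of x] by simp
    then show "d x * d x = (C - c) * (a x * d x) + c * A * d x"
      by (simp only: distrib_right mult.assoc)
  qed
  ultimately have sum_dd: "(\<Sum>x\<in>?P. d x * d x) = (C - c) * (m - R) + c * A * (qint q k * m)"
    by (simp only: sum.distrib sum_d sum_distrib_left[symmetric])
  have "?K * ((qint q k - 1) * (C - c) * m)
      < ?K * (qint q k * m * m - ((C - c) * (m - R) + c * A * (qint q k * m)))"
    using strict unfolding ident sum_dd by (simp only: mult.assoc)
  then have "(qint q k - 1) * (C - c) * m
      < qint q k * m * (A * C) - ((C - c) * (m - R) + c * A * (qint q k * m))"
    by (simp only: AC mult_less_cancel_left_pos[OF K(1)])
  also have "\<dots> = (C - c) * (qint q k * A * m - m + R)"
    by (simp add: algebra_simps)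
  finally have "(C - c) * ((qint q k - 1) * m) < (C - c) * (qint q k * A * m - m + R)"
    by (simp add: mult_ac)
  then have "(qint q k - 1) * m < qint q k * A * m - m + R"
    using Cc by simp
  then have "qint q k * (m - A * m) < R"
    by (simp add: algebra_simps)
  moreover have "R \<le> 2 * (m - A * m)"
    using hoffman by simp
  moreover have "2 * (m - A * m) \<le> qint q k * (m - A * m)"
  proof (rule mult_right_mono)
    have "1 \<le> qint q (k - 1)"
      using qint_mono[of 1 "k - 1" q] k by simp
    then have "2 * 1 \<le> real q * qint q (k - 1)"
      using q_ge_2 by (intro mult_mono) auto
    then show "2 \<le> qint q k" using qk by simp
    show "0 \<le> m - A * m"
      using hoffman inner_on_self_nonneg[of ?X r] by (simp add: R_def)
  qed
  ultimately show False by simp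
qed

end

section \<open>The numerical comparison\<close>

lemma gauss_coeff_shift:
  assumes "q \<ge> 2" "N \<ge> 1"
  shows "qint q N * gauss_coeff q (N - 1) b = qint q (N - b) * gauss_coeff q N b"
proof -
  obtain a where "N = Suc a" using assms(2) by (cases N) auto
  then show ?thesis
    using gauss_coeff_Suc_Suc[OF assms(1), of a b] gauss_coeff_Suc_right[OF assms(1), of N b] by simp
qed

text \<open>The left-hand side is the summand in the Pascal expansion of the count \<open>D\<close>; up to the factor in
  parentheses it grows like \<open>q^m\<close>. Passing from \<open>m\<close> to \<open>m + 1\<close> multiplies it by
  \<open>q (1 - [k - 2] / [n - 2 - m])\<close>, and the quotient is at most \<open>e = q^m / q^(n - k)\<close>. The claim then
  follows from \<open>(1 - e)\<^sup>2 \<ge> 1 - 2 e \<ge> 1 - q e\<close>.\<close>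

lemma meeting_term_lower_bound:
  fixes q k n m :: nat
  assumes q: "q \<ge> 2" and k: "k \<ge> 2" and m: "m + k \<le> n"
  shows "real q ^ (m * (k - 1)) * gauss_coeff q (n - 2 - m) (k - 2)
    \<ge> real q ^ m * (1 - real q ^ m / real q ^ (n - k)) * gauss_coeff q (n - 2) (k - 2)"
  using m
proof (induction m)
  case 0
  have "gauss_coeff q (n - 2) (k - 2) \<ge> 0" by (rule gauss_coeff_nonneg[OF q])
  then show ?case
    using mult_right_mono[of "1 - 1 / real q ^ (n - k)" 1] by simp
next
  case (Suc m)
  define t where "t m = real q ^ (m * (k - 1)) * gauss_coeff q (n - 2 - m) (k - 2)" for m
  define c where "c = gauss_coeff q (n - 2) (k - 2)"
  define e where "e = real q ^ m / real q ^ (n - k)"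
  define N where "N = n - 2 - m"
  have N: "N \<ge> 1" "N = (n - k - m) + (k - 2)" "n - 2 - Suc m = N - 1" "N - (k - 2) = n - k - m"
    using Suc.prems k by (simp_all add: N_def)
  have c: "c \<ge> 0" using gauss_coeff_nonneg[OF q] by (simp add: c_def)
  have t0: "t m \<ge> 0" using gauss_coeff_nonneg[OF q] by (simp add: t_def)
  have qN: "qint q N > 0" using N(1) by (intro qint_pos) simp
  have "real q ^ (n - k) = real q ^ m * real q ^ (n - k - m)"
    using Suc.prems by (simp flip: power_add)
  then have e: "e = 1 / real q ^ (n - k - m)"
    using q by (simp add: e_def)
  have e0: "0 \<le> e" "e \<le> 1"
    using q by (auto simp: e)
  have "real q ^ (n - k - m) * qint q (k - 2) \<le> qint q N"
    unfolding N(2) qint_add by simp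
  then have le: "qint q (k - 2) \<le> e * qint q N"
    using q by (simp add: e field_simps)
  have split: "qint q N = qint q (k - 2) + real q ^ (k - 2) * qint q (n - k - m)"
    using qint_add[of q "k - 2" "n - k - m"] N(2) by (simp add: add.commute)
  have "qint q N * t (Suc m) = real q ^ (k - 1) * real q ^ (m * (k - 1)) * (qint q N * gauss_coeff q (N - 1) (k - 2))"
    unfolding t_def N(3) by (simp add: power_add)
  also have "\<dots> = real q ^ (k - 1) * qint q (n - k - m) * t m"
    unfolding gauss_coeff_shift[OF q N(1)] N(4) by (simp add: t_def N_def)
  also have "real q ^ (k - 1) * qint q (n - k - m) = real q * (qint q N - qint q (k - 2))"
  proof -
    have "k - 1 = Suc (k - 2)" using k by simp
    then show ?thesis by (simp only: split) simp
  qed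
  also have "\<dots> * t m \<ge> real q * ((1 - e) * qint q N) * t m"
    using le t0 by (intro mult_right_mono mult_left_mono) (auto simp: algebra_simps)
  finally have "qint q N * (real q * (1 - e) * t m) \<le> qint q N * t (Suc m)"
    by (simp add: mult_ac)
  then have "real q * (1 - e) * t m \<le> t (Suc m)"
    using qN by simp
  moreover have "real q * (1 - e) * (real q ^ m * (1 - e) * c) \<le> real q * (1 - e) * t m"
    using Suc e0 by (intro mult_left_mono) (auto simp: t_def c_def e_def)
  moreover have "real q ^ Suc m * (1 - real q * e) * c \<le> real q * (1 - e) * (real q ^ m * (1 - e) * c)"
  proof -
    have "2 * e \<le> real q * e" using q e0 by (intro mult_right_mono) auto
    moreover have "(1 - e) * (1 - e) = 1 - 2 * e + e * e"
      by (simp add: algebra_simps)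
    moreover have "0 \<le> e * e" by simp
    ultimately have "1 - real q * e \<le> (1 - e) * (1 - e)"
      by linarith
    then have "real q ^ Suc m * c * (1 - real q * e) \<le> real q ^ Suc m * c * ((1 - e) * (1 - e))"
      using c by (intro mult_left_mono) auto
    then show ?thesis by (simp add: mult_ac)
  qed
  ultimately have "real q ^ Suc m * (1 - real q * e) * c \<le> t (Suc m)"
    by linarith
  then show ?case
    by (simp add: t_def c_def e_def)
qed

text \<open>The union bound would count \<open>[r] c\<close> subspaces; overlaps cost at most one part in \<open>16 = 2^4\<close> when
  \<open>n - k \<ge> r + 3\<close>, by summing the previous lemma.\<close>

lemma meeting_count_lower_bound:
  fixes q k n r :: nat
  assumes q: "q \<ge> 2" and k: "k \<ge> 2" and r: "r + k + 3 \<le> n"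
  shows "gauss_coeff q (n - 1) (k - 1) - real q ^ (r * (k - 1)) * gauss_coeff q (n - 1 - r) (k - 1)
    \<ge> 15 / 16 * qint q r * gauss_coeff q (n - 2) (k - 2)"
  using r
proof (induction r)
  case (Suc r)
  have "real q ^ (r + 4) \<le> real q ^ (n - k)"
    using Suc.prems q by (intro power_increasing) auto
  moreover have "2 ^ 4 \<le> real q ^ 4"
    using q by (intro power_mono) auto
  then have "real q ^ r * 16 \<le> real q ^ (r + 4)"
    unfolding power_add by (intro mult_left_mono) auto
  ultimately have "real q ^ r * 16 \<le> real q ^ (n - k)"
    by linarith
  then have "real q ^ r / real q ^ (n - k) \<le> 1 / 16"
    using q by (simp add: field_simps)
  then have "real q ^ r * (15 / 16) * gauss_coeff q (n - 2) (k - 2)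
      \<le> real q ^ r * (1 - real q ^ r / real q ^ (n - k)) * gauss_coeff q (n - 2) (k - 2)"
    using gauss_coeff_nonneg[OF q] by (intro mult_right_mono mult_left_mono) auto
  also have "\<dots> \<le> real q ^ (r * (k - 1)) * gauss_coeff q (n - 2 - r) (k - 2)"
    using Suc.prems by (intro meeting_term_lower_bound[OF q k]) auto
  also have "gauss_coeff q (n - 2 - r) (k - 2)
      = gauss_coeff q (n - 1 - r) (k - 1) - real q ^ (k - 1) * gauss_coeff q (n - 1 - Suc r) (k - 1)"
  proof -
    have "n - 1 - r = Suc (n - 2 - r)" "n - 1 - Suc r = n - 2 - r" "k - 1 = Suc (k - 2)"
      using Suc.prems k by simp_all
    then show ?thesis
      using gauss_coeff_pascal[OF q, of "n - 2 - r" "k - 2"] by (simp only:)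
  qed
  finally have "15 / 16 * real q ^ r * gauss_coeff q (n - 2) (k - 2)
      \<le> real q ^ (r * (k - 1)) * gauss_coeff q (n - 1 - r) (k - 1)
        - real q ^ (Suc r * (k - 1)) * gauss_coeff q (n - 1 - Suc r) (k - 1)"
    unfolding mult_Suc power_add by (simp add: right_diff_distrib mult_ac)
  then show ?case
    using Suc.IH Suc.prems unfolding qint_Suc distrib_left distrib_right by simp
qed simp

text \<open>All terms are multiples of \<open>c\<close> once \<open>C [k - 1] = [n - 1] c\<close> is used. With \<open>u = q^(s - 2)\<close> the main
  term \<open>[s - 2] [n - 1]\<close> is smaller than its counterpart by a factor of about \<open>q\<close>, the loss
  from \<open>[k] \<le> (q + 1) [k - 1]\<close> is \<open>(q + 1) / q\<close>, and the bound on \<open>n\<close> makes the square term small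
  enough (\<open>MB\<close>). For \<open>q = 2\<close> the constants \<open>4\<close> in \<open>MB\<close> and \<open>15 / 16\<close>
  make the leading coefficients in \<open>u\<close> agree exactly, and the lower-order terms decide.\<close>

lemma size_bound_le_degree_bound:
  fixes q k n s :: nat
  assumes q: "q \<ge> 2" and k: "k \<ge> 2" and s: "s \<ge> 3" and n: "n + s \<ge> 2 * ((s - 1) * k) + k + 4"
  shows "qint q k * (qint q (s - 2) * gauss_coeff q (n - 1) (k - 1)
      + (qint q ((s - 1) * k))\<^sup>2 * gauss_coeff q (n - 2) (k - 2))
    \<le> qint q n * (gauss_coeff q (n - 1) (k - 1)
      - real q ^ ((s - 1) * (k - 1)) * gauss_coeff q (n - s) (k - 1))"
proof -
  define c C where "c = gauss_coeff q (n - 2) (k - 2)" and "C = gauss_coeff q (n - 1) (k - 1)"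
  define D where "D = C - real q ^ ((s - 1) * (k - 1)) * gauss_coeff q (n - s) (k - 1)"
  define A B M u where "A = qint q (n - 1)" and "B = qint q (k - 1)"
    and "M = qint q ((s - 1) * k)" and "u = real q ^ (s - 2)"
  have "2 * (s - 1) \<le> (s - 1) * k" using k by simp
  then have nk: "n \<ge> k + 3 * s" using n s by linarith
  have c: "c \<ge> 0" using gauss_coeff_nonneg[OF q] by (simp add: c_def)
  have q2: "real q \<ge> 2" using q by simp
  have A: "A \<ge> 0" and B: "B \<ge> 1"
    using qint_mono[of 1 "k - 1" q] k by (simp_all add: A_def B_def)
  have D: "15 / 16 * qint q (s - 1) * c \<le> D"
    using meeting_count_lower_bound[OF q k, of "s - 1" n] nk s by (simp add: D_def C_def c_def)
  have C: "C * B = A * c"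
    using gauss_coeff_Suc_Suc[OF q, of "n - 2" "k - 2"] nk k s
    by (simp add: A_def B_def C_def c_def Suc_diff_Suc numeral_2_eq_2)
  have qk: "qint q k \<le> (real q + 1) * B"
    using qint_Suc'[of q "k - 1"] k B by (simp add: B_def algebra_simps)
  have qn: "real q * A \<le> qint q n"
    using qint_Suc'[of q "n - 1"] nk s by (simp add: A_def)
  have qs: "(real q - 1) * qint q (s - 2) = u - 1" "qint q (s - 1) = 1 + real q * qint q (s - 2)"
    using power_eq_qint[of q "s - 2"] qint_Suc'[of q "s - 2"] s
    by (simp_all add: u_def Suc_diff_Suc numeral_2_eq_2)
  have MB: "4 * (real q - 1) * M\<^sup>2 * B \<le> u * A"
  proof -
    have "4 * (real q - 1) \<le> (real q)\<^sup>2 * (real q - 1)\<^sup>2"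
    proof -
      have "(2::real)\<^sup>2 \<le> (real q)\<^sup>2" using q2 by (intro power_mono) auto
      moreover have "real q - 1 \<le> (real q - 1)\<^sup>2"
        using q2 by (simp add: power2_eq_square)
      ultimately show ?thesis using q2 by (intro mult_mono) auto
    qed
    then have "4 * (real q - 1) * (M\<^sup>2 * B) \<le> (real q)\<^sup>2 * (real q - 1)\<^sup>2 * (M\<^sup>2 * B)"
      using B by (intro mult_right_mono) auto
    also have "\<dots> = (real q)\<^sup>2 * ((real q - 1) * M)\<^sup>2 * B"
      by (simp add: power_mult_distrib)
    also have "\<dots> \<le> (real q)\<^sup>2 * (real q ^ ((s - 1) * k))\<^sup>2 * B"
      using q2 B power_eq_qint[of q "(s - 1) * k"]
      by (intro mult_right_mono mult_left_mono power_mono) (auto simp: M_def)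
    also have "\<dots> = real q ^ (2 + 2 * ((s - 1) * k)) * B"
      by (simp add: power_add power_mult power2_eq_square mult.commute[of 2])
    also have "\<dots> \<le> real q ^ ((s - 2) + (n - k)) * B"
      using q2 B n s nk by (intro mult_right_mono power_increasing) auto
    also have "\<dots> = u * (real q ^ (n - k) * B)"
      by (simp add: u_def power_add)
    also have "\<dots> \<le> u * A"
    proof (rule mult_left_mono)
      have "A = qint q (n - k) + real q ^ (n - k) * B"
        using qint_add[of q "n - k" "k - 1"] nk k by (simp add: A_def B_def)
      then show "real q ^ (n - k) * B \<le> A" by simp
    qed (simp add: u_def)
    finally show ?thesis by (simp add: mult.assoc)
  qed
  have key: "(real q + 1) * (qint q (s - 2) * A + M\<^sup>2 * B) \<le> 15 / 16 * (real q * qint q (s - 1)) * A"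
  proof -
    have "4 * (real q + 1) \<le> 3 * (real q)\<^sup>2"
    proof -
      have "0 \<le> (real q - 2) * (3 * real q + 2)" using q2 by simp
      then show ?thesis by (simp add: algebra_simps power2_eq_square)
    qed
    then have "4 * (real q + 1) * (5 * u) \<le> 3 * (real q)\<^sup>2 * (5 * u)"
      by (intro mult_right_mono) (auto simp: u_def)
    then have num: "16 * (real q + 1) * (4 * (u - 1) + u) \<le> 60 * (real q * (real q * (u - 1) + (real q - 1)))"
      using q2 by (simp add: algebra_simps power2_eq_square)
    have "64 * (real q - 1) * ((real q + 1) * (qint q (s - 2) * A + M\<^sup>2 * B))
        = 16 * (real q + 1) * (4 * ((real q - 1) * qint q (s - 2)) * A + 4 * (real q - 1) * M\<^sup>2 * B)"
      by (simp add: algebra_simps)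
    also have "\<dots> \<le> 16 * (real q + 1) * (4 * (u - 1) * A + u * A)"
      unfolding qs(1) by (rule mult_left_mono[OF add_left_mono[OF MB]]) simp
    also have "\<dots> = 16 * (real q + 1) * (4 * (u - 1) + u) * A"
      by (simp add: algebra_simps)
    also have "\<dots> \<le> 60 * (real q * (real q * (u - 1) + (real q - 1))) * A"
      using num A by (intro mult_right_mono)
    also have "\<dots> = 64 * (real q - 1) * (15 / 16 * (real q * qint q (s - 1)) * A)"
      unfolding qs(2) qs(1)[symmetric] by (simp add: field_simps)
    finally show ?thesis
      by (rule mult_left_le_imp_le) (use q2 in simp)
  qed
  have "qint q k * (qint q (s - 2) * C + M\<^sup>2 * c) * B = qint q k * ((qint q (s - 2) * A + M\<^sup>2 * B) * c)"
    using C by (simp add: algebra_simps)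
  also have "\<dots> \<le> (real q + 1) * B * ((qint q (s - 2) * A + M\<^sup>2 * B) * c)"
    using qk A B c by (intro mult_right_mono) auto
  also have "\<dots> = (real q + 1) * (qint q (s - 2) * A + M\<^sup>2 * B) * (c * B)"
    by (simp add: mult_ac)
  also have "\<dots> \<le> 15 / 16 * (real q * qint q (s - 1)) * A * (c * B)"
    using key B c by (intro mult_right_mono) auto
  also have "\<dots> = (real q * A) * (15 / 16 * qint q (s - 1) * c) * B"
    by (simp add: mult_ac)
  also have "\<dots> \<le> qint q n * D * B"
    using qn D A B c q2 by (intro mult_right_mono mult_mono) auto
  finally show ?thesis
    using B by (simp add: D_def C_def c_def M_def)
qed

section \<open>The Ore-degree theorem\<close>

theorem theorem1p3:
  fixes scale :: "'a :: {field, finite} \<Rightarrow> 'v :: ab_group_add \<Rightarrow> 'v"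
    and B :: "'v set"
    and \<F> :: "'v set set"
    and q k s n :: nat
  assumes q: "q = CARD('a)"
    and V: "finite_dimensional_vector_space scale B"
    and n: "vector_space.dim scale (UNIV :: 'v set) = n"
    and k: "k \<ge> 2"
    and s: "s \<ge> 2"
    and n_s2: "s = 2 \<Longrightarrow> n \<ge> 2 * k + 1"
    and n_s3: "s \<ge> 3 \<Longrightarrow> int n \<ge> (2 * int s - 1) * int k - int s + 4"
    and F: "\<F> \<subset> Gr scale k UNIV"
    and ore: "real (ore_degree scale k \<F>) >
      gauss_coeff q k 1 *
        (gauss_coeff q (n - 1) (k - 1)
          - real q ^ ((s - 1) * (k - 1)) * gauss_coeff q (n - s) (k - 1))"
  shows "direct_sum_matching_number scale k \<F> \<ge> s"
proof -
  interpret finite_dimensional_vector_space scale B by (rule V)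
  interpret finite_field_vector_space scale B q by unfold_locales (simp add: q)
  have F': "\<F> \<subseteq> Gr scale k UNIV" using F by blast
  define D where "D = gauss_coeff q (n - 1) (k - 1)
    - real q ^ ((s - 1) * (k - 1)) * gauss_coeff q (n - s) (k - 1)"
  have ore': "real (ore_degree scale k \<F>) > qint q k * D"
    using ore by (simp only: D_def gauss_coeff_1[OF q_ge_2])
  have deg: "real (ore_degree scale k \<F>) \<le> real (subspace_degree scale \<F> S)"
    if "S \<in> Gr scale k UNIV - \<F>" for S
    using ore_degree_le[of S k \<F>] that by simp
  have "\<exists>F. direct_sum_matching scale k \<F> s F"
  proof (rule ccontr)
    assume no: "\<nexists>F. direct_sum_matching scale k \<F> s F"
    show False
    proof (cases "s = 2")
      case True
      then have nk: "2 * k < n" using n_s2 by simp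
      have "S \<inter> T \<noteq> {0}" if "S \<in> \<F>" "T \<in> \<F>" for S T
      proof
        assume ST: "S \<inter> T = {0}"
        have sub: "subspace S" "subspace T" "dim S = k" "dim T = k"
          using that F' by (auto simp: Gr_iff)
        define M where "M i = (if i = 0 then S else T)" for i :: nat
        have "(\<Union>i<2. M i) = S \<union> T"
          by (auto simp: M_def lessThan_Suc numeral_2_eq_2)
        then have "direct_sum_matching scale k \<F> s M"
          using dim_span_Un[OF sub(1,2) ST] sub that True
          by (simp add: direct_sum_matching_def M_def)
        then show False using no by blast
      qed
      then obtain S where S: "S \<in> Gr scale k UNIV - \<F>"
        "real (subspace_degree scale \<F> S) \<le> qint q k * gauss_coeff q (n - 2) (k - 2)"
        using exists_low_degree_if_intersecting[OF n[symmetric] k nk F] by blast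
      moreover have "D = gauss_coeff q (n - 2) (k - 2)"
        using gauss_coeff_pascal[OF q_ge_2, of "n - 2" "k - 2"] True k nk
        by (simp add: D_def Suc_diff_Suc numeral_2_eq_2)
      ultimately show False
        using deg[OF S(1)] ore' by simp
    next
      case False
      then have s3: "s \<ge> 3" using s by simp
      \<comment> \<open>The hypothesis on \<open>n\<close> is linear in this product.\<close>
      define P where "P = (s - 1) * k"
      have "(2 * int s - 1) * int k = 2 * int P + int k"
        using s by (simp add: P_def of_nat_diff algebra_simps)
      then have n1: "n + s \<ge> 2 * P + k + 4"
        using n_s3[OF s3] by linarith
      have "2 * (s - 1) \<le> P" using k by (simp add: P_def)
      then have n2: "k + s - 1 \<le> n" "k \<le> n" using n1 s3 by linarith+
      define C where "C = qint q (s - 2) * gauss_coeff q (n - 1) (k - 1)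
        + (qint q ((s - 1) * k))\<^sup>2 * gauss_coeff q (n - 2) (k - 2)"
      have "real (card \<F>) \<le> C"
        unfolding C_def
        using card_le_if_no_matching[OF n[symmetric] F' k s n2(1) _ no] deg ore'
        unfolding D_def by fastforce
      have "real (ore_degree scale k \<F>) * qint q n \<le> (qint q k)\<^sup>2 * real (card \<F>)"
        unfolding n[symmetric] using k n2(2) n deg by (intro min_degree_le_average[OF F]) auto
      also have "\<dots> \<le> (qint q k)\<^sup>2 * C"
        using \<open>real (card \<F>) \<le> C\<close> by (intro mult_left_mono) auto
      also have "\<dots> = qint q k * (qint q k * C)"
        by (simp add: power2_eq_square)
      also have "\<dots> \<le> qint q k * (qint q n * D)"
        using size_bound_le_degree_bound[OF q_ge_2 k s3, of n] n1
        unfolding C_def D_def P_def by (intro mult_left_mono) auto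
      finally have "real (ore_degree scale k \<F>) * qint q n \<le> (qint q k * D) * qint q n"
        by (simp add: mult_ac)
      then show False
        using ore' qint_pos[of n q] n2 k by simp
    qed
  qed
  moreover have "finite {s. \<exists>F. direct_sum_matching scale k \<F> s F}"
  proof (rule finite_subset)
    show "{s. \<exists>F. direct_sum_matching scale k \<F> s F} \<subseteq> {..n}"
    proof clarify
      fix r M assume "direct_sum_matching scale k \<F> r M"
      then have "r * k = dim (span (\<Union>i<r. M i))"
        by (simp add: direct_sum_matching_def)
      also have "\<dots> \<le> n"
        unfolding n[symmetric] by (rule dim_subset) simp
      finally show "r \<le> n"
        using k by (metis le_trans mult.right_neutral mult_le_mono2 one_le_numeral order_trans)
    qed
  qed simp
  ultimately show ?thesis
    unfolding direct_sum_matching_number_def by (intro Max_ge) auto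
qed

end
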